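(* Let $n\ge 2$ and $a>0$. Then there exist nontrivial bounded solutions of the Navier–Stokes equation on $\mathbb{H}^n(-a^2)$, $$\partial_t U^* - \Delta U^* + \overline{\nabla}_U U^* - 2\,\mathrm{Ric}(U^* ) + dP = 0,\qquad d^*U^*=0;$$ that is, there exist a smooth time-dependent one-form $U^*$ and a smooth scalar function $P$ on $(-\infty,0)\times\mathbb{H}^n(-a^2)$ satisfying these equations, with $U^*$ not identically zero and $\sup_{(t,x)}|U^*(t,x)|<\infty$.
   Context: $\mathbb{H}^n(-a^2)$ is the complete simply connected $n$-dimensional Riemannian manifold of constant sectional curvature $-a^2$. For a Riemannian manifold $(M,g)$: a vector field $U$ is identified with the one-form $U^*$ given by $U^*(Y)=g(U,Y)$; $\overline{\nabla}$ is the Levi-Civita connection on $TM$ and the induced one on $T^*M$, so $\overline{\nabla}_XY^*=(\overline{\nabla}_XY)^*$; $d^*$ is the formal adjoint of $d$; $-\Delta=dd^*+d^*d$ is the Hodge Laplacian; $\mathrm{Ric}$ acting on one-forms is the Ricci operator $\mathrm{Ric}(u^* )=\sum_{i,j}\eta^i\, g(R(e_i,e_j)e_j,u)$ ($e_i$ a local orthonormal frame, $\eta^i$ its dual frame, $R$ the curvature tensor with the sign convention for which $\mathrm{Ric}(\omega)=-(n-1)a^2\omega$ on $\mathbb{H}^n(-a^2)$). $|U^*|$ denotes the pointwise norm induced by $g$. *)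

theory Defs
  imports "HOL-Analysis.Analysis"
begin

section \<open>Smooth maps\<close>

text \<open>The notions below are meant for open \<open>S\<close>; a map is smooth if all its iterated partial
  derivatives exist and are (Frechet) differentiable on \<open>S\<close>.\<close>

primrec Ck_on :: "nat \<Rightarrow> 'a::euclidean_space set \<Rightarrow> ('a \<Rightarrow> 'b::real_normed_vector) \<Rightarrow> bool" where
  "Ck_on 0 S f \<longleftrightarrow> continuous_on S f"
| "Ck_on (Suc k) S f \<longleftrightarrow> (\<forall>x\<in>S. f differentiable (at x)) \<and>
     (\<forall>b\<in>Basis. Ck_on k S (\<lambda>x. frechet_derivative f (at x) b))"

definition smooth_on :: "'a::euclidean_space set \<Rightarrow> ('a \<Rightarrow> 'b::real_normed_vector) \<Rightarrow> bool" where
  "smooth_on S f \<longleftrightarrow> (\<forall>k. Ck_on k S f)"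

definition partial :: "'n \<Rightarrow> (real^'n \<Rightarrow> 'b::real_normed_vector) \<Rightarrow> real^'n \<Rightarrow> 'b" where
  "partial i f x = frechet_derivative f (at x) (axis i 1)"

section \<open>Riemannian geometry in a global chart\<close>

text \<open>A metric on an open set \<open>\<Omega>\<close> of \<open>real^'n\<close> is given by its Gram matrices
  \<open>g x $ i $ j = g\<^sub>x(\<partial>\<^sub>i, \<partial>\<^sub>j)\<close>. Vector fields are given by their components with respect to
  the coordinate frame \<open>\<partial>\<^sub>i\<close>, one-forms by their components with respect to \<open>dx\<^sup>i\<close>, and
  two-forms \<open>\<beta>\<close> by the antisymmetric matrices \<open>\<beta>(\<partial>\<^sub>i, \<partial>\<^sub>j)\<close>.\<close>

type_synonym 'n metric = "real^'n \<Rightarrow> real^'n^'n"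
type_synonym 'n vfield = "real^'n \<Rightarrow> real^'n"
type_synonym 'n oneform = "real^'n \<Rightarrow> real^'n"
type_synonym 'n twoform = "real^'n \<Rightarrow> real^'n^'n"

definition ip :: "'n::finite metric \<Rightarrow> real^'n \<Rightarrow> real^'n \<Rightarrow> real^'n \<Rightarrow> real" where
  "ip g x u v = u \<bullet> (g x *v v)"

definition flat :: "'n::finite metric \<Rightarrow> 'n vfield \<Rightarrow> 'n oneform" where
  "flat g X x = g x *v X x"

definition sharp :: "'n::finite metric \<Rightarrow> 'n oneform \<Rightarrow> 'n vfield" where
  "sharp g \<omega> x = matrix_inv (g x) *v \<omega> x"

definition ip_form1 :: "'n::finite metric \<Rightarrow> real^'n \<Rightarrow> real^'n \<Rightarrow> real^'n \<Rightarrow> real" where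
  "ip_form1 g x \<alpha> \<beta> = \<alpha> \<bullet> (matrix_inv (g x) *v \<beta>)"

text \<open>The factor \<open>1/2\<close> makes the \<open>\<eta>\<^sup>i \<and> \<eta>\<^sup>j\<close> with \<open>i < j\<close> orthonormal for an orthonormal
  coframe \<open>\<eta>\<close>.\<close>

definition ip_form2 :: "'n::finite metric \<Rightarrow> real^'n \<Rightarrow> real^'n^'n \<Rightarrow> real^'n^'n \<Rightarrow> real" where
  "ip_form2 g x \<alpha> \<beta> = (1/2) * (\<Sum>i\<in>UNIV. \<Sum>j\<in>UNIV. \<Sum>k\<in>UNIV. \<Sum>l\<in>UNIV.
     matrix_inv (g x) $ i $ k * matrix_inv (g x) $ j $ l * \<alpha> $ i $ j * \<beta> $ k $ l)"

definition form_norm :: "'n::finite metric \<Rightarrow> 'n oneform \<Rightarrow> real^'n \<Rightarrow> real" where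
  "form_norm g \<omega> x = sqrt (ip_form1 g x (\<omega> x) (\<omega> x))"

subsection \<open>Levi-Civita connection and curvature\<close>

text \<open>\<open>christoffel g x k i j\<close> is the symbol with upper index \<open>k\<close> and lower indices \<open>i\<close>, \<open>j\<close>.\<close>

definition christoffel :: "'n::finite metric \<Rightarrow> real^'n \<Rightarrow> 'n \<Rightarrow> 'n \<Rightarrow> 'n \<Rightarrow> real" where
  "christoffel g x k i j = (1/2) * (\<Sum>l\<in>UNIV. matrix_inv (g x) $ k $ l *
     (partial i (\<lambda>y. g y $ j $ l) x + partial j (\<lambda>y. g y $ i $ l) x - partial l (\<lambda>y. g y $ i $ j) x))"

definition cov :: "'n::finite metric \<Rightarrow> 'n vfield \<Rightarrow> 'n vfield \<Rightarrow> 'n vfield" where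
  "cov g X Y x = frechet_derivative Y (at x) (X x)
     + (\<chi> k. \<Sum>i\<in>UNIV. \<Sum>j\<in>UNIV. christoffel g x k i j * X x $ i * Y x $ j)"

definition cov_form :: "'n::finite metric \<Rightarrow> 'n vfield \<Rightarrow> 'n oneform \<Rightarrow> 'n oneform" where
  "cov_form g X \<omega> = flat g (cov g X (sharp g \<omega>))"

definition lie_bracket :: "'n::finite vfield \<Rightarrow> 'n vfield \<Rightarrow> 'n vfield" where
  "lie_bracket X Y x = frechet_derivative Y (at x) (X x) - frechet_derivative X (at x) (Y x)"

definition curvature :: "'n::finite metric \<Rightarrow> 'n vfield \<Rightarrow> 'n vfield \<Rightarrow> 'n vfield \<Rightarrow> 'n vfield" where
  "curvature g X Y Z x =
     cov g X (cov g Y Z) x - cov g Y (cov g X Z) x - cov g (lie_bracket X Y) Z x"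

text \<open>The curvature is tensorial, so its value on tangent vectors at \<open>x\<close> may be computed with
  arbitrary extensions, here those with constant components.\<close>

definition curvature_at ::
    "'n::finite metric \<Rightarrow> real^'n \<Rightarrow> real^'n \<Rightarrow> real^'n \<Rightarrow> real^'n \<Rightarrow> real^'n" where
  "curvature_at g x u v w = curvature g (\<lambda>_. u) (\<lambda>_. v) (\<lambda>_. w) x"

definition orthonormal_frame_at :: "'n::finite metric \<Rightarrow> real^'n \<Rightarrow> ('n \<Rightarrow> real^'n) \<Rightarrow> bool" where
  "orthonormal_frame_at g x e \<longleftrightarrow> (\<forall>i j. ip g x (e i) (e j) = (if i = j then 1 else 0))"

text \<open>The result does not depend on the chosen frame. The dual frame of an orthonormal frame \<open>e\<close>
  consists of the one-forms \<open>\<eta>\<^sup>i = g(e\<^sub>i, \<cdot>)\<close>, with components \<open>g x *v e i\<close>.\<close>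

definition ricci :: "'n::finite metric \<Rightarrow> 'n oneform \<Rightarrow> 'n oneform" where
  "ricci g \<omega> x = (let e = (SOME e. orthonormal_frame_at g x e) in
     \<Sum>i\<in>UNIV. \<Sum>j\<in>UNIV. ip g x (curvature_at g x (e i) (e j) (e j)) (sharp g \<omega> x) *\<^sub>R (g x *v e i))"

subsection \<open>Exterior derivative, its formal adjoint, and the Hodge Laplacian\<close>

definition d_fun :: "(real^'n \<Rightarrow> real) \<Rightarrow> 'n::finite oneform" where
  "d_fun f x = (\<chi> i. partial i f x)"

definition d_form :: "'n::finite oneform \<Rightarrow> 'n twoform" where
  "d_form \<omega> x = (\<chi> i j. partial i (\<lambda>y. \<omega> y $ j) x - partial j (\<lambda>y. \<omega> y $ i) x)"

definition integral_vol :: "(real^'n::finite) set \<Rightarrow> 'n metric \<Rightarrow> (real^'n \<Rightarrow> real) \<Rightarrow> real" where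
  "integral_vol \<Omega> g f = (LINT x:\<Omega>|lborel. f x * sqrt (det (g x)))"

definition test_on :: "(real^'n::finite) set \<Rightarrow> (real^'n \<Rightarrow> 'b::real_normed_vector) \<Rightarrow> bool" where
  "test_on \<Omega> \<phi> \<longleftrightarrow> smooth_on \<Omega> \<phi> \<and> (\<exists>K. compact K \<and> K \<subseteq> \<Omega> \<and> (\<forall>x\<in>\<Omega> - K. \<phi> x = 0))"

text \<open>\<open>d\<^sup>*\<omega> = f\<close> and \<open>d\<^sup>*\<beta> = \<theta>\<close> in the sense of the formal adjoint; on \<open>\<Omega>\<close> the smooth
  field \<open>f\<close> resp. \<open>\<theta>\<close> is uniquely determined by this.\<close>

definition is_codiff1 ::
    "(real^'n::finite) set \<Rightarrow> 'n metric \<Rightarrow> 'n oneform \<Rightarrow> (real^'n \<Rightarrow> real) \<Rightarrow> bool" where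
  "is_codiff1 \<Omega> g \<omega> f \<longleftrightarrow> smooth_on \<Omega> f \<and>
     (\<forall>\<phi> :: real^'n \<Rightarrow> real. test_on \<Omega> \<phi> \<longrightarrow>
        integral_vol \<Omega> g (\<lambda>x. \<phi> x * f x) = integral_vol \<Omega> g (\<lambda>x. ip_form1 g x (d_fun \<phi> x) (\<omega> x)))"

definition is_codiff2 ::
    "(real^'n::finite) set \<Rightarrow> 'n metric \<Rightarrow> 'n twoform \<Rightarrow> 'n oneform \<Rightarrow> bool" where
  "is_codiff2 \<Omega> g \<beta> \<theta> \<longleftrightarrow> smooth_on \<Omega> \<theta> \<and>
     (\<forall>\<phi> :: 'n oneform. test_on \<Omega> \<phi> \<longrightarrow>
        integral_vol \<Omega> g (\<lambda>x. ip_form1 g x (\<phi> x) (\<theta> x)) =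
        integral_vol \<Omega> g (\<lambda>x. ip_form2 g x (d_form \<phi> x) (\<beta> x)))"

text \<open>\<open>L = \<Delta>\<omega>\<close>, where \<open>-\<Delta> = d d\<^sup>* + d\<^sup>* d\<close>.\<close>

definition is_hodge_laplacian ::
    "(real^'n::finite) set \<Rightarrow> 'n metric \<Rightarrow> 'n oneform \<Rightarrow> 'n oneform \<Rightarrow> bool" where
  "is_hodge_laplacian \<Omega> g \<omega> L \<longleftrightarrow> (\<exists>f \<theta>. is_codiff1 \<Omega> g \<omega> f \<and> is_codiff2 \<Omega> g (d_form \<omega>) \<theta> \<and>
     (\<forall>x\<in>\<Omega>. - L x = d_fun f x + \<theta> x))"

section \<open>The Navier--Stokes equation on \<open>(-\<infinity>, 0) \<times> \<Omega>\<close>\<close>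

text \<open>\<open>U t\<close> is the one-form \<open>U\<^sup>*\<close> at time \<open>t\<close>; the vector field \<open>U\<close> itself is
  \<open>sharp g (U t)\<close>.\<close>

definition navier_stokes_solution ::
    "(real^'n::finite) set \<Rightarrow> 'n metric \<Rightarrow> (real \<Rightarrow> 'n oneform) \<Rightarrow> (real \<Rightarrow> real^'n \<Rightarrow> real) \<Rightarrow> bool"
  where
  "navier_stokes_solution \<Omega> g U P \<longleftrightarrow>
     smooth_on ({..<0} \<times> \<Omega>) (\<lambda>(t, x). U t x) \<and>
     smooth_on ({..<0} \<times> \<Omega>) (\<lambda>(t, x). P t x) \<and>
     (\<forall>t<0.
        (\<exists>L. is_hodge_laplacian \<Omega> g (U t) L \<and>
           (\<forall>x\<in>\<Omega>. vector_derivative (\<lambda>s. U s x) (at t) - L x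
              + cov_form g (sharp g (U t)) (U t) x - 2 *\<^sub>R ricci g (U t) x + d_fun (P t) x = 0)) \<and>
        is_codiff1 \<Omega> g (U t) (\<lambda>_. 0))"

section \<open>Hyperbolic space\<close>

text \<open>The space of constant curvature \<open>-a\<^sup>2\<close> in the Poincare ball model: the open unit ball with
  the metric \<open>4 |dx|\<^sup>2 / (a\<^sup>2 (1 - |x|\<^sup>2)\<^sup>2)\<close>.\<close>

definition hyp_space :: "(real^'n::finite) set" where
  "hyp_space = ball 0 1"

definition hyp_metric :: "real \<Rightarrow> 'n::finite metric" where
  "hyp_metric a x = mat (4 / (a\<^sup>2 * (1 - (norm x)\<^sup>2)\<^sup>2))"

section \<open>Consistency of the definitions\<close>

text \<open>\<open>cov\<close> is torsion free and metric. The ball model has constant sectional curvature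
  \<open>-a\<^sup>2\<close> and its Ricci operator is multiplication by \<open>-(n-1)a\<^sup>2\<close>.\<close>

lemma matrix_inv_right: "invertible (A :: real^'n::finite^'n) \<Longrightarrow> A ** matrix_inv A = mat 1"
  unfolding invertible_def matrix_inv_def by (rule someI2_ex) auto

lemma matrix_inv_mat:
  assumes "c \<noteq> 0"
  shows "matrix_inv (mat c :: real^'n::finite^'n) = mat (1/c)"
proof -
  have *: "(mat p ** mat q :: real^'n^'n) = mat (p * q)" for p q :: real
    unfolding matrix_matrix_mult_def mat_def
    by (auto simp: vec_eq_iff if_distrib[of "\<lambda>z. z * _"] if_distrib[of "\<lambda>z. _ * z"]
          sum.delta' cong: if_cong)
  have "invertible (mat c :: real^'n^'n)"
    unfolding invertible_def using assms by (intro exI[of _ "mat (1/c)"]) (simp add: *)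
  from matrix_inv_right[OF this] have "mat (1/c) ** (mat c ** matrix_inv (mat c :: real^'n^'n)) = mat (1/c)"
    by simp
  then show ?thesis using assms by (simp add: matrix_mul_assoc *)
qed

lemma frechet_eqI: "(f has_derivative f') (at x) \<Longrightarrow> frechet_derivative f (at x) = f'"
  by (metis frechet_derivative_at)

lemma frechet_cong_open:
  assumes "open S" "x \<in> S" "\<And>y. y \<in> S \<Longrightarrow> f y = g y" "(g has_derivative g') (at x)"
  shows "frechet_derivative f (at x) = g'"
  by (rule frechet_eqI) (metis assms has_derivative_transform_within_open)

lemma matvec_mat: "(mat c :: real^'n::finite^'n) *v v = c *\<^sub>R v"
  by (simp add: vec_eq_iff matrix_vector_mult_def mat_def if_distrib[of "\<lambda>z. z * _"] sum.delta' cong: if_cong)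

lemma torsion_free:
  fixes g :: "'n::finite metric"
  assumes "open \<Omega>" "x \<in> \<Omega>" and sym: "\<And>y i j. y \<in> \<Omega> \<Longrightarrow> g y $ i $ j = g y $ j $ i"
    and "g differentiable (at x)"
  shows "cov g X Y x - cov g Y X x = lie_bracket X Y x"
proof -
  have dg: "((\<lambda>y. g y $ i $ j) has_derivative (\<lambda>h. frechet_derivative g (at x) h $ i $ j)) (at x)" for i j
    using assms(4) unfolding frechet_derivative_works
    by (intro bounded_linear.has_derivative[OF bounded_linear_vec_nth])
  have "partial l (\<lambda>y. g y $ i $ j) x = partial l (\<lambda>y. g y $ j $ i) x" for i j l
    unfolding partial_def frechet_eqI[OF dg]
    using frechet_cong_open[OF assms(1,2) sym dg] frechet_eqI[OF dg] by metis
  then have C: "christoffel g x k i j = christoffel g x k j i" for k i j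
    unfolding christoffel_def by (simp add: algebra_simps)
  have "(\<Sum>i\<in>UNIV. \<Sum>j\<in>UNIV. christoffel g x k i j * X x $ i * Y x $ j)
     = (\<Sum>i\<in>UNIV. \<Sum>j\<in>UNIV. christoffel g x k i j * Y x $ i * X x $ j)" for k
    by (subst sum.swap) (simp add: C[of k] mult_ac)
  then show ?thesis by (simp add: cov_def lie_bracket_def)
qed

lemma metric_compatible:
  fixes g :: "'n::finite metric"
  assumes "open \<Omega>" "x \<in> \<Omega>" and sym: "\<And>y i j. y \<in> \<Omega> \<Longrightarrow> g y $ i $ j = g y $ j $ i"
    and inv: "invertible (g x)"
    and "g differentiable (at x)" "Y differentiable (at x)" "Z differentiable (at x)"
  shows "frechet_derivative (\<lambda>y. ip g y (Y y) (Z y)) (at x) (X x)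
    = ip g x (cov g X Y x) (Z x) + ip g x (Y x) (cov g X Z x)"
proof -
  let ?D = "frechet_derivative g (at x)"
  have Dg: "(g has_derivative ?D) (at x)"
    using assms(5) unfolding frechet_derivative_works .
  have dg: "((\<lambda>y. g y $ i $ j) has_derivative (\<lambda>h. ?D h $ i $ j)) (at x)" for i j
    using Dg by (intro bounded_linear.has_derivative[OF bounded_linear_vec_nth])
  have par: "partial l (\<lambda>y. g y $ i $ j) x = ?D (axis l 1) $ i $ j" for i j l
    unfolding partial_def frechet_eqI[OF dg] ..
  have Dsym: "?D h $ i $ j = ?D h $ j $ i" for h i j
    using frechet_cong_open[OF assms(1,2) sym dg, of i j] frechet_eqI[OF dg, of i j]
    by metis
  have lin: "linear ?D" using Dg has_derivative_linear by blast
  have Dexp: "?D h = (\<Sum>l\<in>UNIV. h $ l *\<^sub>R ?D (axis l 1))" for h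
  proof -
    have "?D h = ?D (\<Sum>l\<in>UNIV. h $ l *\<^sub>R axis l 1)"
      by (metis basis_expansion scalar_mult_eq_scaleR)
    then show ?thesis by (simp add: linear_sum[OF lin] linear_cmul[OF lin])
  qed
  define G where "G m i j = (\<Sum>k\<in>UNIV. g x $ m $ k * christoffel g x k i j)" for m i j
  have gi: "g x ** matrix_inv (g x) = mat 1"
    by (rule matrix_inv_right[OF inv])
  have gij: "(\<Sum>k\<in>UNIV. g x $ m $ k * matrix_inv (g x) $ k $ l) = (if m = l then 1 else 0)" for m l
    using arg_cong[OF gi, of "\<lambda>M. M $ m $ l"] by (simp add: matrix_matrix_mult_def mat_def)
  have G: "G m i j = (1/2) * (?D (axis i 1) $ j $ m + ?D (axis j 1) $ i $ m - ?D (axis m 1) $ i $ j)"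
    for m i j
  proof -
    let ?E = "\<lambda>l. (?D (axis i 1) $ j $ l + ?D (axis j 1) $ i $ l - ?D (axis l 1) $ i $ j)"
    have "G m i j = (1/2) * (\<Sum>k\<in>UNIV. \<Sum>l\<in>UNIV. g x $ m $ k * matrix_inv (g x) $ k $ l * ?E l)"
      unfolding G_def christoffel_def par
      by (simp add: sum_distrib_left mult_ac)
    also have "\<dots> = (1/2) * (\<Sum>l\<in>UNIV. (\<Sum>k\<in>UNIV. g x $ m $ k * matrix_inv (g x) $ k $ l) * ?E l)"
      by (subst sum.swap) (simp add: sum_distrib_right)
    also have "\<dots> = (1/2) * ?E m" unfolding gij
      by (simp add: if_distrib[of "\<lambda>z. z * _"] sum.delta' cong: if_cong)
    finally show ?thesis .
  qed
  define A where "A V W = (\<chi> k. \<Sum>i\<in>UNIV. \<Sum>j\<in>UNIV. christoffel g x k i j * V $ i * W $ j)" for V W :: "real^'n"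
  have gA: "ip g x W (A U V) = (\<Sum>m\<in>UNIV. \<Sum>i\<in>UNIV. \<Sum>j\<in>UNIV. G m i j * W $ m * U $ i * V $ j)" for U V W
  proof -
    have "(\<Sum>k\<in>UNIV. g x $ m $ k * A U V $ k) = (\<Sum>i\<in>UNIV. \<Sum>j\<in>UNIV. G m i j * U $ i * V $ j)" for m
    proof -
      have "(\<Sum>k\<in>UNIV. g x $ m $ k * A U V $ k) = 
         (\<Sum>k\<in>UNIV. \<Sum>i\<in>UNIV. \<Sum>j\<in>UNIV. g x $ m $ k * christoffel g x k i j * U $ i * V $ j)"
        unfolding A_def by (simp add: sum_distrib_left mult.assoc)
      also have "\<dots> = (\<Sum>i\<in>UNIV. \<Sum>k\<in>UNIV. \<Sum>j\<in>UNIV. g x $ m $ k * christoffel g x k i j * U $ i * V $ j)"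
        by (rule sum.swap)
      also have "\<dots> = (\<Sum>i\<in>UNIV. \<Sum>j\<in>UNIV. \<Sum>k\<in>UNIV. g x $ m $ k * christoffel g x k i j * U $ i * V $ j)"
        by (intro sum.cong refl sum.swap)
      finally show ?thesis unfolding G_def by (simp add: sum_distrib_right)
    qed
    then show ?thesis unfolding ip_def inner_vec_def matrix_vector_mult_def
      by (simp add: sum_distrib_left mult_ac)
  qed
  have ipsym: "ip g x U V = ip g x V U" for U V
  proof -
    have "transpose (g x) = g x" using sym[OF assms(2)] by (simp add: transpose_def vec_eq_iff)
    then show ?thesis unfolding ip_def
      by (metis dot_lmul_matrix inner_commute transpose_matrix_vector)
  qed
  have key: "ip g x W (A U V) + ip g x V (A U W) = W \<bullet> (?D U *v V)" for U V W
  proof -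
    have "ip g x V (A U W) = (\<Sum>m\<in>UNIV. \<Sum>j\<in>UNIV. \<Sum>i\<in>UNIV. G m i j * V $ m * U $ i * W $ j)"
      unfolding gA by (intro sum.cong refl sum.swap)
    also have "\<dots> = (\<Sum>j\<in>UNIV. \<Sum>m\<in>UNIV. \<Sum>i\<in>UNIV. G m i j * V $ m * U $ i * W $ j)"
      by (rule sum.swap)
    also have "\<dots> = (\<Sum>j\<in>UNIV. \<Sum>i\<in>UNIV. \<Sum>m\<in>UNIV. G m i j * V $ m * U $ i * W $ j)"
      by (intro sum.cong refl sum.swap)
    finally have B: "ip g x V (A U W)
       = (\<Sum>j\<in>UNIV. \<Sum>i\<in>UNIV. \<Sum>m\<in>UNIV. G m i j * V $ m * U $ i * W $ j)" .
    have "ip g x W (A U V) + ip g x V (A U W)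
       = (\<Sum>m\<in>UNIV. \<Sum>i\<in>UNIV. \<Sum>j\<in>UNIV. (G m i j + G j i m) * W $ m * U $ i * V $ j)"
      unfolding gA[of W U V] B sum.distrib[symmetric] by (simp only: ring_distribs mult_ac)
    also have "\<dots> = (\<Sum>m\<in>UNIV. \<Sum>i\<in>UNIV. \<Sum>j\<in>UNIV. ?D (axis i 1) $ m $ j * W $ m * U $ i * V $ j)"
    proof -
      have "G m i j + G j i m = ?D (axis i 1) $ m $ j" for m i j
        unfolding G using Dsym[of "axis i 1" j m] Dsym[of "axis j 1" i m] Dsym[of "axis m 1" i j] by (simp add: field_simps)
      then show ?thesis by simp
    qed
    also have "\<dots> = (\<Sum>m\<in>UNIV. \<Sum>j\<in>UNIV. \<Sum>i\<in>UNIV. ?D (axis i 1) $ m $ j * W $ m * U $ i * V $ j)"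
      by (intro sum.cong refl sum.swap)
    also have "\<dots> = W \<bullet> (?D U *v V)"
    proof -
      have "?D U $ m $ j = (\<Sum>i\<in>UNIV. U $ i * ?D (axis i 1) $ m $ j)" for m j
        by (subst Dexp) simp
      then show ?thesis
        unfolding inner_vec_def matrix_vector_mult_def
        by (simp add: sum_distrib_left sum_distrib_right mult_ac)
    qed
    finally show ?thesis .
  qed
  let ?Y = "frechet_derivative Y (at x)" and ?Z = "frechet_derivative Z (at x)"
  have bb: "bounded_bilinear (\<lambda>(M::real^'n^'n) v. M *v v)"
    unfolding bilinear_conv_bounded_bilinear[symmetric] bilinear_def
    by (auto intro!: linearI simp: vec_eq_iff matrix_vector_mult_def sum.distrib
        sum_distrib_left algebra_simps)
  have "((\<lambda>y. ip g y (Y y) (Z y)) has_derivative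
     (\<lambda>h. Y x \<bullet> (g x *v ?Z h + ?D h *v Z x) + ?Y h \<bullet> (g x *v Z x))) (at x)"
    unfolding ip_def
    by (intro has_derivative_inner bounded_bilinear.FDERIV[OF bb] Dg)
      (use assms(6,7) in \<open>simp_all add: frechet_derivative_works\<close>)
  from frechet_eqI[OF this]
  have "frechet_derivative (\<lambda>y. ip g y (Y y) (Z y)) (at x) (X x)
    = ip g x (Y x) (?Z (X x)) + Y x \<bullet> (?D (X x) *v Z x) + ip g x (?Y (X x)) (Z x)"
    by (simp add: ip_def inner_add_right)
  also have "\<dots> = ip g x (?Y (X x) + A (X x) (Y x)) (Z x) + ip g x (Y x) (?Z (X x) + A (X x) (Z x))"
    unfolding key[symmetric] using ipsym[of "A (X x) (Y x)" "Z x"]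
    by (simp add: ip_def inner_add_left inner_add_right matrix_vector_right_distrib)
  finally show ?thesis by (simp add: cov_def A_def)
qed

lemma hyp_metric_symmetric: "hyp_metric a x $ i $ j = hyp_metric a x $ j $ i"
  by (simp add: hyp_metric_def mat_def)

text \<open>The bilinear form given by the Christoffel symbols of \<open>hyp_metric\<close>.\<close>

definition hG :: "real^'n::finite \<Rightarrow> real^'n \<Rightarrow> real^'n \<Rightarrow> real^'n" where
  "hG x u v = (2 / (1 - x \<bullet> x)) *\<^sub>R ((x \<bullet> v) *\<^sub>R u + (x \<bullet> u) *\<^sub>R v - (u \<bullet> v) *\<^sub>R x)"

lemma hyp_inner_less: "x \<in> hyp_space \<Longrightarrow> x \<bullet> x < 1"
  by (simp add: hyp_space_def dot_square_norm power_less_one_iff abs_square_less_1)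

lemma hyp_partial:
  assumes "x \<in> hyp_space" "a > 0"
  shows "partial l (\<lambda>y. hyp_metric a y $ i $ j) x =
    (if i = j then 16 * x $ l / (a\<^sup>2 * (1 - x \<bullet> x)^3) else 0)"
proof -
  have 1: "1 - x \<bullet> x \<noteq> 0" using hyp_inner_less[OF assms(1)] by simp
  have A: "((\<lambda>s. 4 / (a\<^sup>2 * (1 - s)\<^sup>2)) has_derivative
     (*) (8 / (a\<^sup>2 * (1 - x \<bullet> x)^3))) (at (x \<bullet> x))"
  proof -
    have "((\<lambda>s. a\<^sup>2 * (1 - s)\<^sup>2) has_real_derivative - (2 * a\<^sup>2 * (1 - x \<bullet> x))) (at (x \<bullet> x))"
      by (auto intro!: derivative_eq_intros simp: algebra_simps)
    moreover have "a\<^sup>2 * (1 - x \<bullet> x)\<^sup>2 \<noteq> 0" using 1 assms(2) by simp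
    ultimately have D: "((\<lambda>s. 4 * inverse (a\<^sup>2 * (1 - s)\<^sup>2)) has_real_derivative
       4 * - (inverse (a\<^sup>2 * (1 - x \<bullet> x)\<^sup>2) * - (2 * a\<^sup>2 * (1 - x \<bullet> x))
         * inverse (a\<^sup>2 * (1 - x \<bullet> x)\<^sup>2))) (at (x \<bullet> x))"
      by (intro DERIV_cmult DERIV_inverse')
    have E: "4 * - (inverse (a\<^sup>2 * q\<^sup>2) * - (2 * a\<^sup>2 * q) * inverse (a\<^sup>2 * q\<^sup>2)) = 8 / (a\<^sup>2 * q^3)"
      if "q \<noteq> 0" for q :: real
      using that assms(2) by (simp add: divide_simps power2_eq_square power3_eq_cube)
    show ?thesis
      using DERIV_cong[OF D E[OF 1]] unfolding has_field_derivative_def by (simp only: divide_inverse)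
  qed
  have B: "((\<lambda>y. y \<bullet> y) has_derivative (\<lambda>h. 2 * (x \<bullet> h))) (at x)"
    by (rule derivative_eq_intros refl)+ (simp add: inner_commute)
  have C: "frechet_derivative (\<lambda>y. 4 / (a\<^sup>2 * (1 - y \<bullet> y)\<^sup>2)) (at x) =
     (\<lambda>h. 8 / (a\<^sup>2 * (1 - x \<bullet> x)^3) * (2 * (x \<bullet> h)))"
    using has_derivative_compose[OF B A] by (rule frechet_eqI)
  show ?thesis
  proof (cases "i = j")
    case True
    then show ?thesis
      by (simp add: partial_def hyp_metric_def mat_def power2_norm_eq_inner C inner_axis)
  next
    case False
    then show ?thesis
      by (simp add: partial_def hyp_metric_def mat_def frechet_eqI[OF has_derivative_const])
  qed
qed

lemma hyp_christoffel:
  assumes "x \<in> hyp_space" "a > 0"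
  shows "christoffel (hyp_metric a) x k i j = (2 / (1 - x \<bullet> x)) *
    ((if i = k then x $ j else 0) + (if j = k then x $ i else 0) - (if i = j then x $ k else 0))"
proof -
  have 1: "1 - x \<bullet> x \<noteq> 0" using hyp_inner_less[OF assms(1)] by simp
  have "matrix_inv (hyp_metric a x) = mat (a\<^sup>2 * (1 - x \<bullet> x)\<^sup>2 / 4)"
    unfolding hyp_metric_def power2_norm_eq_inner by (subst matrix_inv_mat) (use 1 assms in auto)
  then have "christoffel (hyp_metric a) x k i j = (1/2) * (\<Sum>l\<in>UNIV.
      if k = l then a\<^sup>2 * (1 - x \<bullet> x)\<^sup>2 / 4 * (16 / (a\<^sup>2 * (1 - x \<bullet> x)^3)) *
       ((if j = l then x $ i else 0) + (if i = l then x $ j else 0) - (if i = j then x $ l else 0)) else 0)"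
    unfolding christoffel_def hyp_partial[OF assms]
    by (intro arg_cong[of _ _ "\<lambda>z. (1/2) * z"] sum.cong refl)
      (simp add: mat_def diff_divide_distrib add_divide_distrib)
  also have "\<dots> = (1/2) * (a\<^sup>2 * (1 - x \<bullet> x)\<^sup>2 / 4 * (16 / (a\<^sup>2 * (1 - x \<bullet> x)^3))) *
       ((if j = k then x $ i else 0) + (if i = k then x $ j else 0) - (if i = j then x $ k else 0))"
    by (simp only: sum.delta' finite_class.finite_UNIV) simp
  also have "(1/2) * (a\<^sup>2 * (1 - x \<bullet> x)\<^sup>2 / 4 * (16 / (a\<^sup>2 * (1 - x \<bullet> x)^3))) = 2 / (1 - x \<bullet> x)"
    using 1 assms(2) by (simp add: divide_simps power2_eq_square power3_eq_cube)
  finally show ?thesis by (simp only: add.commute)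
qed

lemma hyp_cov:
  assumes "x \<in> hyp_space" "a > 0"
  shows "cov (hyp_metric a) X Y x = frechet_derivative Y (at x) (X x) + hG x (X x) (Y x)"
proof -
  have "(\<Sum>i\<in>UNIV. \<Sum>j\<in>UNIV. christoffel (hyp_metric a) x k i j * X x $ i * Y x $ j) = hG x (X x) (Y x) $ k" for k
  proof -
    let ?c = "2 / (1 - x \<bullet> x)"
    have "(\<Sum>i\<in>UNIV. \<Sum>j\<in>UNIV. christoffel (hyp_metric a) x k i j * X x $ i * Y x $ j)
      = ?c * ((\<Sum>i\<in>UNIV. \<Sum>j\<in>UNIV. if i = k then X x $ i * (x $ j * Y x $ j) else 0)
        + (\<Sum>i\<in>UNIV. \<Sum>j\<in>UNIV. if j = k then (x $ i * X x $ i) * Y x $ j else 0)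
        - (\<Sum>i\<in>UNIV. \<Sum>j\<in>UNIV. if i = j then x $ k * (X x $ i * Y x $ j) else 0))"
      unfolding hyp_christoffel[OF assms] sum_distrib_left sum.distrib[symmetric] sum_subtractf[symmetric]
      by (intro sum.cong refl) (auto simp: algebra_simps)
    also have "(\<Sum>i\<in>UNIV. \<Sum>j\<in>UNIV. if i = k then X x $ i * (x $ j * Y x $ j) else 0) = X x $ k * (x \<bullet> Y x)"
      by (subst sum.swap) (simp add: sum.delta' inner_vec_def sum_distrib_left)
    also have "(\<Sum>i\<in>UNIV. \<Sum>j\<in>UNIV. if j = k then (x $ i * X x $ i) * Y x $ j else 0) = (x \<bullet> X x) * Y x $ k"
      by (simp add: sum.delta' inner_vec_def sum_distrib_right)
    also have "(\<Sum>i\<in>UNIV. \<Sum>j\<in>UNIV. if i = j then x $ k * (X x $ i * Y x $ j) else 0) = x $ k * (X x \<bullet> Y x)"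
      by (simp add: sum.delta inner_vec_def sum_distrib_left)
    finally show ?thesis by (simp add: hG_def mult_ac)
  qed
  then show ?thesis by (simp add: cov_def vec_eq_iff)
qed

lemma hyp_curvature:
  fixes u v w x :: "real^'n::finite"
  assumes x: "x \<in> hyp_space" and a: "a > 0"
  shows "curvature_at (hyp_metric a) x u v w =
    - a\<^sup>2 *\<^sub>R (ip (hyp_metric a) x v w *\<^sub>R u - ip (hyp_metric a) x u w *\<^sub>R v)"
proof -
  define q where "q = 1 - x \<bullet> x"
  have q: "q \<noteq> 0" using hyp_inner_less[OF x] by (simp add: q_def)
  define B where "B p r = (x \<bullet> r) *\<^sub>R p + (x \<bullet> p) *\<^sub>R r - (p \<bullet> r) *\<^sub>R x" for p r
  have o: "open (hyp_space :: (real^'n) set)" by (simp add: hyp_space_def)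
  have c0: "cov (hyp_metric a) (\<lambda>_. p) (\<lambda>_. r) y = hG y p r" if "y \<in> hyp_space" for p r y :: "real^'n"
    using hyp_cov[OF that a] by (simp add: frechet_eqI[OF has_derivative_const])
  have dG: "((\<lambda>y. hG y p r) has_derivative
     (\<lambda>h. (4 * (x \<bullet> h) / q\<^sup>2) *\<^sub>R B p r
        + (2 / q) *\<^sub>R ((h \<bullet> r) *\<^sub>R p + (h \<bullet> p) *\<^sub>R r - (p \<bullet> r) *\<^sub>R h))) (at x)" for p r
  proof -
    have "((\<lambda>s. 2 * inverse (1 - s)) has_real_derivative 2 * - (inverse (1 - x \<bullet> x) * (-1) * inverse (1 - x \<bullet> x))) (at (x \<bullet> x))"
      using q unfolding q_def
      by (intro DERIV_cmult DERIV_inverse') (auto intro!: derivative_eq_intros)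
    then have A: "((\<lambda>s. 2 / (1 - s)) has_derivative (*) (2 / q\<^sup>2)) (at (x \<bullet> x))"
      by (simp add: has_field_derivative_def q_def[symmetric] power2_eq_square divide_inverse mult_ac)
    have B: "((\<lambda>y. y \<bullet> y) has_derivative (\<lambda>h. 2 * (x \<bullet> h))) (at x)"
      by (rule derivative_eq_intros refl)+ (simp add: inner_commute)
    have D1: "((\<lambda>y. 2 / (1 - y \<bullet> y)) has_derivative (\<lambda>h. 2 / q\<^sup>2 * (2 * (x \<bullet> h)))) (at x)"
      by (rule has_derivative_compose[OF B A])
    have D2: "((\<lambda>y. (y \<bullet> r) *\<^sub>R p + (y \<bullet> p) *\<^sub>R r - (p \<bullet> r) *\<^sub>R y) has_derivative
       (\<lambda>h. (h \<bullet> r) *\<^sub>R p + (h \<bullet> p) *\<^sub>R r - (p \<bullet> r) *\<^sub>R h)) (at x)"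
      by (intro bounded_linear_imp_has_derivative bounded_linear_sub bounded_linear_add
        bounded_linear_scaleR_left[THEN bounded_linear_compose] bounded_linear_inner_left
        bounded_linear_scaleR_right)
    show ?thesis
      unfolding hG_def
      by (rule has_derivative_eq_rhs[OF has_derivative_scaleR[OF D1 D2]])
        (simp add: fun_eq_iff B_def q_def[symmetric] add.commute)
  qed
  have c1: "cov (hyp_metric a) (\<lambda>_. s) (cov (hyp_metric a) (\<lambda>_. p) (\<lambda>_. r)) x =
     (4 * (x \<bullet> s) / q\<^sup>2) *\<^sub>R B p r
        + (2 / q) *\<^sub>R ((s \<bullet> r) *\<^sub>R p + (s \<bullet> p) *\<^sub>R r - (p \<bullet> r) *\<^sub>R s)
        + (4/q\<^sup>2) *\<^sub>R B s (B p r)" for s p r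
  proof -
    have F: "frechet_derivative (cov (hyp_metric a) (\<lambda>_. p) (\<lambda>_. r)) (at x) =
       (\<lambda>h. (4 * (x \<bullet> h) / q\<^sup>2) *\<^sub>R B p r
        + (2 / q) *\<^sub>R ((h \<bullet> r) *\<^sub>R p + (h \<bullet> p) *\<^sub>R r - (p \<bullet> r) *\<^sub>R h))"
      by (rule frechet_cong_open[OF o x _ dG]) (rule c0)
    have "hG x s (hG x p r) = (4/q\<^sup>2) *\<^sub>R B s (B p r)"
      by (simp add: hG_def B_def q_def[symmetric] power2_eq_square inner_add_right inner_diff_right algebra_simps)
    then show ?thesis
      unfolding hyp_cov[OF x a] F by (simp add: c0[OF x])
  qed
  have lb: "cov (hyp_metric a) (lie_bracket (\<lambda>_. u) (\<lambda>_. v)) (\<lambda>_. w) x = 0"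
    unfolding hyp_cov[OF x a] lie_bracket_def by (simp add: frechet_eqI[OF has_derivative_const] hG_def)
  have ipq: "ip (hyp_metric a) x p r = (4 / (a\<^sup>2 * q\<^sup>2)) * (p \<bullet> r)" for p r
    by (simp add: ip_def hyp_metric_def matvec_mat q_def power2_norm_eq_inner)
  have BB: "(x \<bullet> u) *\<^sub>R B v w + B u (B v w) - (x \<bullet> v) *\<^sub>R B u w - B v (B u w)
      = (x \<bullet> x) *\<^sub>R ((u \<bullet> w) *\<^sub>R v - (v \<bullet> w) *\<^sub>R u)"
    by (simp add: B_def vec_eq_iff inner_add_right inner_diff_right inner_commute) (simp add: algebra_simps)
  have "curvature_at (hyp_metric a) x u v w =
     (4 / q\<^sup>2) *\<^sub>R ((x \<bullet> u) *\<^sub>R B v w + B u (B v w) - (x \<bullet> v) *\<^sub>R B u w - B v (B u w))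
     + (4 / q) *\<^sub>R ((u \<bullet> w) *\<^sub>R v - (v \<bullet> w) *\<^sub>R u)"
    unfolding curvature_at_def curvature_def c1 lb
    by (simp add: inner_commute vec_eq_iff diff_divide_distrib add_divide_distrib algebra_simps)
  also have "\<dots> = (4 * (x \<bullet> x) / q\<^sup>2 + 4 / q) *\<^sub>R ((u \<bullet> w) *\<^sub>R v - (v \<bullet> w) *\<^sub>R u)"
    unfolding BB by (simp add: scaleR_add_left)
  also have "4 * (x \<bullet> x) / q\<^sup>2 + 4 / q = 4 / q\<^sup>2"
    using q by (simp add: divide_simps q_def power2_eq_square)
  finally show ?thesis using a q by (simp add: ipq vec_eq_iff field_simps)
qed

lemma hyp_ricci:
  fixes x :: "real^'n::finite"
  assumes x: "x \<in> hyp_space" and a: "a > 0"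
  shows "ricci (hyp_metric a) \<omega> x = (- (real CARD('n) - 1) * a\<^sup>2) *\<^sub>R \<omega> x"
proof -
  define c where "c = 4 / (a\<^sup>2 * (1 - x \<bullet> x)\<^sup>2)"
  have c: "c > 0" using a hyp_inner_less[OF x] by (simp add: c_def)
  have g: "hyp_metric a x = mat c" by (simp add: hyp_metric_def c_def power2_norm_eq_inner)
  have ipc: "ip (hyp_metric a) x p r = c * (p \<bullet> r)" for p r by (simp add: ip_def g matvec_mat)
  have "orthonormal_frame_at (hyp_metric a) x (\<lambda>i. axis i (1 / sqrt c))"
    using c by (auto simp: orthonormal_frame_at_def ipc inner_axis_axis)
  then have ex: "\<exists>e. orthonormal_frame_at (hyp_metric a) x e" by blast
  define e where "e = (SOME e. orthonormal_frame_at (hyp_metric a) x e)"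
  have "orthonormal_frame_at (hyp_metric a) x e" unfolding e_def by (rule someI_ex[OF ex])
  then have e: "c * (e i \<bullet> e j) = (if i = j then 1 else 0)" for i j
    by (simp add: orthonormal_frame_at_def ipc)
  have R: "(\<Sum>j\<in>UNIV. curvature_at (hyp_metric a) x (e i) (e j) (e j)) = (- a\<^sup>2 * (real CARD('n) - 1)) *\<^sub>R e i" for i
  proof -
    have "(\<Sum>j\<in>UNIV. curvature_at (hyp_metric a) x (e i) (e j) (e j)) =
        (\<Sum>j\<in>UNIV. - a\<^sup>2 *\<^sub>R e i + (if i = j then a\<^sup>2 *\<^sub>R e i else 0))"
      unfolding hyp_curvature[OF x a] ipc e by (intro sum.cong refl) (auto simp: algebra_simps)
    also have "\<dots> = (- a\<^sup>2 * (real CARD('n) - 1)) *\<^sub>R e i"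
      unfolding sum.distrib sum_constant_scaleR by (simp add: sum.delta' algebra_simps)
    finally show ?thesis .
  qed
  have ex: "(\<Sum>i\<in>UNIV. (c * (e i \<bullet> w)) *\<^sub>R e i) = w" for w
  proof -
    have ne: "e i \<noteq> 0" for i using e[of i i] by auto
    have ort: "e i \<bullet> e j = 0" if "i \<noteq> j" for i j using e[of i j] that c by simp
    have inj: "inj e" using ort ne by (metis injI inner_eq_zero_iff)
    have ind: "independent (range e)"
      by (rule pairwise_orthogonal_independent) (auto simp: pairwise_def orthogonal_def ne intro: ort)
    have "UNIV \<subseteq> span (range e)"
      by (rule card_ge_dim_independent[OF subset_UNIV ind]) (simp add: card_image[OF inj])
    then have "w \<in> span (range e)" by blast
    then obtain k where w: "w = (\<Sum>v\<in>range e. k v *\<^sub>R v)" by (auto simp: span_finite)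
    then have w: "w = (\<Sum>i\<in>UNIV. k (e i) *\<^sub>R e i)" by (simp add: sum.reindex[OF inj])
    have "c * (e i \<bullet> w) = k (e i)" for i
    proof -
      have "c * (e i \<bullet> w) = (\<Sum>j\<in>UNIV. k (e j) * (c * (e i \<bullet> e j)))"
        by (subst w) (simp add: inner_sum_right sum_distrib_left mult_ac)
      also have "\<dots> = k (e i)" unfolding e by (simp add: if_distrib sum.delta' cong: if_cong)
      finally show ?thesis .
    qed
    then show ?thesis using w by simp
  qed
  have lin: "(\<Sum>j\<in>UNIV. ip (hyp_metric a) x (curvature_at (hyp_metric a) x (e i) (e j) (e j)) (sharp (hyp_metric a) \<omega> x))
      = (- a\<^sup>2 * (real CARD('n) - 1)) * (e i \<bullet> \<omega> x)" for i
  proof -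
    have "sharp (hyp_metric a) \<omega> x = (1/c) *\<^sub>R \<omega> x"
      using c by (simp add: sharp_def g matrix_inv_mat matvec_mat)
    then show ?thesis
      using c by (simp add: ipc sum_distrib_left[symmetric] inner_sum_left[symmetric] sum_divide_distrib[symmetric] R)
  qed
  have "ricci (hyp_metric a) \<omega> x = (\<Sum>i\<in>UNIV. ((- a\<^sup>2 * (real CARD('n) - 1)) * (e i \<bullet> \<omega> x)) *\<^sub>R (c *\<^sub>R e i))"
    unfolding ricci_def e_def[symmetric] Let_def scaleR_sum_left[symmetric] lin by (simp add: g matvec_mat)
  also have "\<dots> = (- a\<^sup>2 * (real CARD('n) - 1)) *\<^sub>R (\<Sum>i\<in>UNIV. (c * (e i \<bullet> \<omega> x)) *\<^sub>R e i)"
    by (simp add: scaleR_sum_right mult_ac)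
  finally show ?thesis unfolding ex by (simp add: vec_eq_iff algebra_simps)
qed

lemma hyp_metric_pos:
  fixes v :: "real^'n::finite"
  assumes "x \<in> hyp_space" "a > 0" "v \<noteq> 0"
  shows "ip (hyp_metric a) x v v > 0"
  using assms hyp_inner_less[OF assms(1)]
  by (simp add: ip_def hyp_metric_def matvec_mat power2_norm_eq_inner)

lemma hyp_sectional_curvature:
  assumes "x \<in> hyp_space" "a > 0"
    and "ip (hyp_metric a) x u u = 1" "ip (hyp_metric a) x v v = 1" "ip (hyp_metric a) x u v = 0"
  shows "ip (hyp_metric a) x (curvature_at (hyp_metric a) x u v v) u = - a\<^sup>2"
  unfolding hyp_curvature[OF assms(1,2)] assms(4,5) using assms(3) by (simp add: ip_def)

end

theory Submission
  imports Defs
begin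

text \<open>A potential flow \<open>U = dF\<close> of a harmonic function \<open>F\<close> is a stationary solution. Its Hodge Laplacian
vanishes, the convection term is \<open>d (|U|\<^sup>2 / 2)\<close>, and since the Ricci operator is multiplication by the constant
\<open>- (n - 1) a\<^sup>2\<close>, the Ricci term is exact as well; the pressure \<open>P = - |U|\<^sup>2 / 2 - 2 (n - 1) a\<^sup>2 F\<close> absorbs
both (\<open>hyp_potential_flow_navier_stokes\<close>). It remains to find a harmonic function whose gradient is bounded and
not zero.

Let \<open>r\<close> be the signed distance to a totally geodesic hyperplane. In Fermi coordinates the metric is
\<open>dr\<^sup>2 + cosh\<^sup>2(a r) h\<close> with \<open>h\<close> the metric of the hyperplane, so a function \<open>F(r)\<close> is harmonic if and only if
\<open>F'' + (n - 1) a tanh(a r) F' = 0\<close>, which has the solution \<open>F' = cosh(a r)\<^sup>1\<^sup>-\<^sup>n\<close>. Its gradient has norm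
at most \<open>1\<close>. In the ball, \<open>s = sinh(a r)\<close> is the rational function \<open>2 (e \<bullet> x) / (1 - |x|\<^sup>2)\<close> for a unit vector
\<open>e\<close>, and up to the factor \<open>a\<close> the flow is \<open>U = (1 + s\<^sup>2)\<^sup>-\<^sup>n\<^sup>/\<^sup>2 ds\<close>, with
\<open>|U| \<le> a\<close> (\<open>potential_flow_bounded\<close>). The potential is an antiderivative of the profile composed with \<open>s\<close>.

The codifferential is characterised by integration against test functions. That \<open>U\<close> is coclosed is thus an
instance of the divergence theorem for compactly supported fields (\<open>integral_divergence_free\<close>) together with a
pointwise Euclidean divergence (\<open>potential_flow_divergence\<close>); the closed form \<open>U\<close> has \<open>dU = 0\<close> pointwise.\<close>

section \<open>Calculus of smooth maps\<close>

lemma frechet_derivative_cong_open: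
  assumes "open S" "x \<in> S" "\<And>y. y \<in> S \<Longrightarrow> f y = g y"
  shows "frechet_derivative f (at x) = frechet_derivative g (at x)"
proof -
  have "(f has_derivative D) (at x) \<longleftrightarrow> (g has_derivative D) (at x)" for D
    using assms by (metis has_derivative_transform_within_open)
  then show ?thesis unfolding frechet_derivative_def by simp
qed

lemma Ck_on_cong:
  assumes "open S" "\<And>x. x \<in> S \<Longrightarrow> f x = g x"
  shows "Ck_on k S f \<longleftrightarrow> Ck_on k S g"
  using assms(2)
proof (induction k arbitrary: f g)
  case 0
  then show ?case by (auto intro: continuous_on_cong)
next
  case (Suc k)
  have "f differentiable (at x) \<longleftrightarrow> g differentiable (at x)" if "x \<in> S" for x
    unfolding differentiable_def
    using has_derivative_transform_within_open[OF _ assms(1) that] Suc.prems by metis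
  moreover have "Ck_on k S (\<lambda>x. frechet_derivative f (at x) b) \<longleftrightarrow>
      Ck_on k S (\<lambda>x. frechet_derivative g (at x) b)" for b
    by (rule Suc.IH) (use frechet_derivative_cong_open[OF assms(1)] Suc.prems in metis)
  ultimately show ?case by simp
qed

text \<open>Differentiability is checked with an arbitrary formula \<open>D\<close> for the derivative, so that the
choice made by \<open>frechet_derivative\<close> never has to be computed.\<close>

lemma Ck_on_SucI:
  assumes "open S" "\<And>x. x \<in> S \<Longrightarrow> (f has_derivative D x) (at x)"
    and "\<And>b. b \<in> Basis \<Longrightarrow> Ck_on k S (\<lambda>x. D x b)"
  shows "Ck_on (Suc k) S f"
proof -
  have "Ck_on k S (\<lambda>x. frechet_derivative f (at x) b)" if "b \<in> Basis" for b
    using assms(3)[OF that] Ck_on_cong[OF assms(1), of "\<lambda>x. frechet_derivative f (at x) b" "\<lambda>x. D x b" k]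
      frechet_eqI[OF assms(2)] by simp
  then show ?thesis using assms(2) by (auto simp: differentiable_def)
qed

lemma Ck_on_has_derivative:
  assumes "Ck_on (Suc k) S f" "x \<in> S"
  shows "(f has_derivative frechet_derivative f (at x)) (at x)"
  using assms by (simp add: frechet_derivative_works)

lemma Ck_on_SucD: "Ck_on (Suc k) S f \<Longrightarrow> Ck_on k S f"
proof (induction k arbitrary: f)
  case 0
  then show ?case
    by (auto intro!: continuous_at_imp_continuous_on differentiable_imp_continuous_within)
next
  case (Suc k)
  have "Ck_on k S (\<lambda>x. frechet_derivative f (at x) b)" if "b \<in> Basis" for b
    by (rule Suc.IH) (use Suc.prems[unfolded Ck_on.simps(2)[of "Suc k"]] that in blast)
  then show ?case using Suc.prems by (simp only: Ck_on.simps) blast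
qed

lemma Ck_on_const: "Ck_on k S (\<lambda>_. c)"
proof (induction k arbitrary: c)
  case 0
  then show ?case by simp
next
  case (Suc k)
  then show ?case by (simp add: frechet_eqI[OF has_derivative_const])
qed

lemma Ck_on_bounded_linear:
  assumes "bounded_linear f" "open S"
  shows "Ck_on k S f"
proof (cases k)
  case 0
  then show ?thesis by (simp add: assms(1) linear_continuous_on)
next
  case (Suc m)
  show ?thesis unfolding Suc
    by (rule Ck_on_SucI[OF assms(2) bounded_linear_imp_has_derivative[OF assms(1)] Ck_on_const])
qed

lemma Ck_on_add:
  assumes "open S" "Ck_on k S f" "Ck_on k S g"
  shows "Ck_on k S (\<lambda>x. f x + g x)"
  using assms(2,3)
proof (induction k arbitrary: f g)
  case 0
  then show ?case by (simp add: continuous_on_add)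
next
  case (Suc k)
  show ?case
    by (rule Ck_on_SucI[OF assms(1) has_derivative_add[OF Ck_on_has_derivative[OF Suc.prems(1)]
            Ck_on_has_derivative[OF Suc.prems(2)]]])
      (use Suc in auto)
qed

lemma Ck_on_bilinear:
  assumes "bounded_bilinear mul" "open S" "Ck_on k S f" "Ck_on k S g"
  shows "Ck_on k S (\<lambda>x. mul (f x) (g x))"
  using assms(3,4)
proof (induction k arbitrary: f g)
  case 0
  then show ?case by (simp add: bounded_bilinear.continuous_on[OF assms(1)])
next
  case (Suc k)
  have "Ck_on k S f" "Ck_on k S g" using Suc.prems Ck_on_SucD by auto
  then have "Ck_on k S (\<lambda>x. mul (f x) (frechet_derivative g (at x) b) + mul (frechet_derivative f (at x) b) (g x))"
    if "b \<in> Basis" for b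
    using Suc that by (auto intro!: Ck_on_add[OF assms(2)])
  then show ?case
    by (intro Ck_on_SucI[OF assms(2) bounded_bilinear.FDERIV[OF assms(1) Ck_on_has_derivative[OF Suc.prems(1)]
            Ck_on_has_derivative[OF Suc.prems(2)]]])
qed

text \<open>By the chain rule the derivative in direction \<open>b\<close> is a product of the derivative of \<open>f\<close> and
of another function composed with \<open>f\<close>, which is why the induction runs over all outer
functions \<open>G\<close>.\<close>

lemma Ck_on_compose_real:
  fixes G :: "real \<Rightarrow> real" and f :: "'a::euclidean_space \<Rightarrow> real"
  assumes "open S" "open T" "f ` S \<subseteq> T" "Ck_on k T G" "Ck_on k S f"
  shows "Ck_on k S (\<lambda>x. G (f x))"
  using assms(4,5)
proof (induction k arbitrary: G)
  case 0
  then show ?case using assms(3) by (auto intro: continuous_on_compose2)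
next
  case (Suc k)
  have D: "((\<lambda>x. G (f x)) has_derivative
      (\<lambda>h. frechet_derivative G (at (f x)) (frechet_derivative f (at x) h))) (at x)" if "x \<in> S" for x
    using has_derivative_compose[OF Ck_on_has_derivative[OF Suc.prems(2) that]
        Ck_on_has_derivative[OF Suc.prems(1)]] that assms(3) by auto
  have lin: "frechet_derivative G (at (f x)) r = r * frechet_derivative G (at (f x)) 1" if "x \<in> S" for x r
    using linear_cmul[OF has_derivative_linear[OF Ck_on_has_derivative[OF Suc.prems(1)]], of "f x" r 1]
      that assms(3) by auto
  have D': "((\<lambda>x. G (f x)) has_derivative
      (\<lambda>h. frechet_derivative f (at x) h * frechet_derivative G (at (f x)) 1)) (at x)" if "x \<in> S" for x
    by (rule has_derivative_eq_rhs[OF D[OF that]]) (rule ext, rule lin[OF that])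
  have C: "Ck_on k S (\<lambda>x. frechet_derivative f (at x) b * frechet_derivative G (at (f x)) 1)"
    if "b \<in> Basis" for b
  proof (rule Ck_on_bilinear[OF bounded_bilinear_mult assms(1)])
    show "Ck_on k S (\<lambda>x. frechet_derivative f (at x) b)" using Suc.prems(2) that by simp
    have "Ck_on k T (\<lambda>r. frechet_derivative G (at r) 1)" using Suc.prems(1) by simp
    then show "Ck_on k S (\<lambda>x. frechet_derivative G (at (f x)) 1)"
      by (rule Suc.IH[OF _ Ck_on_SucD[OF Suc.prems(2)]])
  qed
  show ?case by (rule Ck_on_SucI[OF assms(1) D' C])
qed

lemma Ck_on_real_SucI:
  fixes G :: "real \<Rightarrow> real"
  assumes "open T" "\<And>r. r \<in> T \<Longrightarrow> (G has_real_derivative G' r) (at r)" "Ck_on k T G'"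
  shows "Ck_on (Suc k) T G"
  by (rule Ck_on_SucI[OF assms(1) assms(2)[unfolded has_field_derivative_def]]) (use assms(3) in auto)

text \<open>The derivative of a power is a multiple of a power with another exponent, so the induction has to
treat all exponents at once.\<close>

lemma smooth_on_powr: "smooth_on {0<..} (\<lambda>r::real. r powr p)"
proof -
  have "Ck_on k {0<..} (\<lambda>r::real. r powr p)" for k
  proof (induction k arbitrary: p)
    case 0
    show ?case by (auto intro!: continuous_intros)
  next
    case (Suc k)
    show ?case
      by (rule Ck_on_real_SucI[where G' = "\<lambda>r. p * r powr (p - 1)"])
        (auto intro!: has_real_derivative_powr Ck_on_bilinear[OF bounded_bilinear_mult] Ck_on_const Suc)
  qed
  then show ?thesis by (simp add: smooth_on_def)
qed

lemma smooth_on_const: "smooth_on S (\<lambda>_. c)"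
  by (simp add: smooth_on_def Ck_on_const)

lemma smooth_on_bounded_linear: "bounded_linear f \<Longrightarrow> open S \<Longrightarrow> smooth_on S f"
  by (simp add: smooth_on_def Ck_on_bounded_linear)

lemma smooth_on_add: "open S \<Longrightarrow> smooth_on S f \<Longrightarrow> smooth_on S g \<Longrightarrow> smooth_on S (\<lambda>x. f x + g x)"
  by (simp add: smooth_on_def Ck_on_add)

lemma smooth_on_bilinear:
  "bounded_bilinear mul \<Longrightarrow> open S \<Longrightarrow> smooth_on S f \<Longrightarrow> smooth_on S g \<Longrightarrow> smooth_on S (\<lambda>x. mul (f x) (g x))"
  by (simp add: smooth_on_def Ck_on_bilinear)

lemmas smooth_on_mult = smooth_on_bilinear[OF bounded_bilinear_mult]
lemmas smooth_on_scaleR = smooth_on_bilinear[OF bounded_bilinear_scaleR]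
lemmas smooth_on_inner = smooth_on_bilinear[OF bounded_bilinear_inner]

lemma smooth_on_diff:
  assumes "open S" "smooth_on S f" "smooth_on S g"
  shows "smooth_on S (\<lambda>x. f x - g x)"
  using smooth_on_add[OF assms(1,2) smooth_on_scaleR[OF assms(1) smooth_on_const[of S "-1"] assms(3)]]
  by simp

lemma smooth_on_power:
  fixes f :: "'a::euclidean_space \<Rightarrow> real"
  assumes "open S" "smooth_on S f"
  shows "smooth_on S (\<lambda>x. f x ^ m)"
proof (induction m)
  case 0
  show ?case by (simp add: smooth_on_const)
next
  case (Suc m)
  then show ?case by (simp add: smooth_on_mult assms)
qed

lemma smooth_on_cong: "open S \<Longrightarrow> (\<And>x. x \<in> S \<Longrightarrow> f x = g x) \<Longrightarrow> smooth_on S f \<longleftrightarrow> smooth_on S g"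
  unfolding smooth_on_def using Ck_on_cong by metis

lemma smooth_on_compose_real:
  fixes G :: "real \<Rightarrow> real"
  shows "open S \<Longrightarrow> open T \<Longrightarrow> f ` S \<subseteq> T \<Longrightarrow> smooth_on T G \<Longrightarrow> smooth_on S f \<Longrightarrow> smooth_on S (\<lambda>x. G (f x))"
  by (simp add: smooth_on_def Ck_on_compose_real)

lemma smooth_on_inverse:
  fixes f :: "'a::euclidean_space \<Rightarrow> real"
  assumes "open S" "smooth_on S f" "\<And>x. x \<in> S \<Longrightarrow> 0 < f x"
  shows "smooth_on S (\<lambda>x. inverse (f x))"
proof -
  have "smooth_on S (\<lambda>x. f x powr (-1))"
    by (rule smooth_on_compose_real[OF assms(1) _ _ smooth_on_powr assms(2)]) (use assms(3) in auto)
  then show ?thesis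
    by (subst smooth_on_cong[OF assms(1), where g = "\<lambda>x. f x powr (-1)"])
      (use assms(3) in \<open>auto simp: powr_minus less_imp_le\<close>)
qed

lemma smooth_on_real_antiderivative:
  fixes G :: "real \<Rightarrow> real"
  assumes "open T" "\<And>r. r \<in> T \<Longrightarrow> (G has_real_derivative G' r) (at r)" "smooth_on T G'"
  shows "smooth_on T G"
proof -
  have "Ck_on k T G" for k
    using Ck_on_SucD[OF Ck_on_real_SucI[OF assms(1,2), of k]] assms(3) by (simp add: smooth_on_def)
  then show ?thesis by (simp add: smooth_on_def)
qed

section \<open>The divergence theorem for compactly supported fields\<close>

text \<open>The integral of \<open>\<psi>\<close> is invariant under translation, so all difference quotients
\<open>(\<psi>(x + h e) - \<psi>(x)) / h\<close> have integral zero. By the mean value theorem they are bounded by the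
supremum of the directional derivative, and for \<open>h \<le> 1\<close> they are supported in a fixed ball, so dominated
convergence passes to the limit \<open>h \<rightarrow> 0\<close>.\<close>

lemma integral_partial_compact_support_zero:
  fixes \<psi> :: "real^'n::finite \<Rightarrow> real"
  assumes K: "compact K" and supp: "\<And>x. x \<notin> K \<Longrightarrow> \<psi> x = 0"
    and D: "\<And>x. (\<psi> has_derivative D x) (at x)"
    and cont: "continuous_on UNIV (\<lambda>x. D x e)"
  shows "integrable lborel (\<lambda>x. D x e)" "(LINT x|lborel. D x e) = 0"
proof -
  have D0: "D x e = 0" if "x \<notin> K" for x
  proof -
    have "((\<lambda>_. 0) has_derivative D x) (at x)"
      by (rule has_derivative_transform_within_open[OF D, of "- K"])
        (use supp that compact_imp_closed[OF K] in auto)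
    then show ?thesis using has_derivative_unique[OF _ has_derivative_const] by metis
  qed
  have contp: "continuous_on UNIV \<psi>"
    using D by (meson has_derivative_continuous continuous_at_imp_continuous_on)
  have int0: "integrable lborel f" if f: "continuous_on UNIV f" "\<And>x. x \<notin> K \<Longrightarrow> f x = 0" for f :: "real^'n \<Rightarrow> real"
  proof -
    have "integrable lborel (\<lambda>x. indicator K x *\<^sub>R f x)"
      by (rule borel_integrable_compact[OF K continuous_on_subset[OF f(1)]]) simp
    also have "(\<lambda>x. indicator K x *\<^sub>R f x) = f" using f(2) by (auto simp: fun_eq_iff indicator_def)
    finally show ?thesis .
  qed
  show I: "integrable lborel (\<lambda>x. D x e)" by (rule int0[OF cont D0])
  have "bounded ((\<lambda>x. D x e) ` K)"
    by (intro compact_imp_bounded compact_continuous_image continuous_on_subset[OF cont] K) simp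
  then obtain M where M: "\<And>x. x \<in> K \<Longrightarrow> \<bar>D x e\<bar> \<le> M" and M0: "M > 0"
    unfolding bounded_pos by auto
  then have M: "\<bar>D x e\<bar> \<le> M" for x using D0[of x] by (cases "x \<in> K") auto
  obtain R where R: "\<And>x. x \<in> K \<Longrightarrow> norm x \<le> R"
    using compact_imp_bounded[OF K] unfolding bounded_iff by auto
  \<comment> \<open>a ball that contains the supports of all difference quotients with step at most \<open>1\<close>\<close>
  define B where "B = cball (0 :: real^'n) (R + norm e)"
  define h where "h k = 1 / real (Suc k)" for k
  have h: "0 < h k" "h k \<le> 1" for k by (simp_all add: h_def)
  define q where "q k x = (\<psi> (x + h k *\<^sub>R e) - \<psi> x) / h k" for k x
  have Dline: "((\<lambda>t. \<psi> (x + t *\<^sub>R e)) has_real_derivative D (x + t *\<^sub>R e) e) (at t)" for x t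
  proof -
    have "((\<lambda>t. \<psi> (x + t *\<^sub>R e)) has_derivative (\<lambda>r. D (x + t *\<^sub>R e) (r *\<^sub>R e))) (at t)"
      by (rule has_derivative_compose[OF _ D]) (auto intro!: derivative_eq_intros)
    moreover have "D (x + t *\<^sub>R e) (r *\<^sub>R e) = D (x + t *\<^sub>R e) e * r" for r
      using linear_cmul[OF has_derivative_linear[OF D]] by simp
    ultimately show ?thesis by (simp add: has_field_derivative_def)
  qed
  have lim: "(\<lambda>k. q k x) \<longlonglongrightarrow> D x e" for x
  proof -
    have "((\<lambda>t. (\<psi> (x + t *\<^sub>R e) - \<psi> x) / t) \<longlongrightarrow> D x e) (at 0)"
      using Dline[of x 0] by (simp add: has_field_derivative_iff)
    moreover have "filterlim h (at 0) sequentially"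
    proof -
      have "h \<longlonglongrightarrow> 0"
        unfolding h_def using LIMSEQ_inverse_real_of_nat by (simp add: inverse_eq_divide)
      then show ?thesis unfolding filterlim_at using h(1) by (simp add: less_imp_neq[symmetric])
    qed
    ultimately show ?thesis unfolding q_def by (rule filterlim_compose)
  qed
  have bnd: "norm (q k x) \<le> M * indicator B x" for k x
  proof (cases "x \<in> B")
    case True
    obtain z where "\<psi> (x + h k *\<^sub>R e) - \<psi> (x + 0 *\<^sub>R e) = (h k - 0) * D (x + z *\<^sub>R e) e"
      using MVT2[OF h(1)[of k] Dline[of x]] by metis
    then have "q k x = D (x + z *\<^sub>R e) e" using h(1)[of k] by (simp add: q_def)
    then show ?thesis using M True by simp
  next
    case False
    then have "norm x > R + norm e" by (simp add: B_def)
    moreover have "norm (h k *\<^sub>R e) \<le> norm e" using h[of k] by (simp add: mult_left_le_one_le)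
    ultimately have "R < norm x" "R < norm (x + h k *\<^sub>R e)"
      using norm_diff_ineq[of x "h k *\<^sub>R e"] norm_ge_zero[of e] by linarith+
    then have "q k x = 0" using supp R unfolding q_def by (metis diff_0 div_0 leD minus_zero)
    then show ?thesis using False by simp
  qed
  have trans: "continuous_on UNIV (\<lambda>x. \<psi> (x + c))" for c
    by (rule continuous_on_compose2[OF contp]) (auto intro!: continuous_intros)
  have shift: "integrable lborel (\<lambda>x. \<psi> (x + c)) \<and> (LINT x|lborel. \<psi> (x + c)) = (LINT x|lborel. \<psi> x)" for c
  proof -
    have m: "\<psi> \<in> borel_measurable borel" using contp by (rule borel_measurable_continuous_onI)
    have "integrable (distr lborel borel ((+) c)) \<psi> \<longleftrightarrow> integrable lborel (\<lambda>x. \<psi> (c + x))"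
      by (rule integrable_distr_eq) (use m in auto)
    moreover have "integral\<^sup>L (distr lborel borel ((+) c)) \<psi> = (LINT x|lborel. \<psi> (c + x))"
      by (rule integral_distr) (use m in auto)
    ultimately show ?thesis using int0[OF contp supp] by (simp add: lborel_distr_plus add.commute)
  qed
  have q0: "(LINT x|lborel. q k x) = 0" for k
    unfolding q_def using shift[of "h k *\<^sub>R e"] int0[OF contp supp] by simp
  have "(\<lambda>k. LINT x|lborel. q k x) \<longlonglongrightarrow> (LINT x|lborel. D x e)"
  proof (rule integral_dominated_convergence)
    show "(\<lambda>x. D x e) \<in> borel_measurable lborel" using I by simp
    show "q k \<in> borel_measurable lborel" for k
      unfolding q_def using shift[of "h k *\<^sub>R e"] int0[OF contp supp] by (intro borel_measurable_integrable) simp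
    show "integrable lborel (\<lambda>x. M * indicator B x)"
      using borel_integrable_compact[of B "\<lambda>_. M"] by (simp add: B_def mult.commute)
    show "AE x in lborel. (\<lambda>k. q k x) \<longlonglongrightarrow> D x e" using lim by simp
    show "AE x in lborel. norm (q k x) \<le> M * indicator B x" for k using bnd by simp
  qed
  then show "(LINT x|lborel. D x e) = 0" by (simp add: q0 LIMSEQ_const_iff)
qed

text \<open>A function on \<open>\<Omega>\<close> that vanishes off the compact set \<open>K\<close> is extended by zero; the extension is
continuously differentiable because \<open>\<Omega>\<close> and the complement of \<open>K\<close> are open and cover the space.\<close>

lemma integral_partial_zero:
  fixes \<psi> :: "real^'n::finite \<Rightarrow> real"
  assumes \<Omega>: "open \<Omega>" and C1: "Ck_on 1 \<Omega> \<psi>"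
    and K: "compact K" "K \<subseteq> \<Omega>" and supp: "\<And>x. x \<in> \<Omega> - K \<Longrightarrow> \<psi> x = 0"
  shows "set_integrable lborel \<Omega> (partial i \<psi>)" "(LINT x:\<Omega>|lborel. partial i \<psi> x) = 0"
proof -
  define D where "D x = (if x \<in> \<Omega> then frechet_derivative \<psi> (at x) else (\<lambda>_. 0))" for x
  define \<psi>0 where "\<psi>0 x = (if x \<in> \<Omega> then \<psi> x else 0)" for x
  have oK: "open (- K)" using compact_imp_closed[OF K(1)] by auto
  have d: "(\<psi> has_derivative frechet_derivative \<psi> (at x)) (at x)" if "x \<in> \<Omega>" for x
    by (rule Ck_on_has_derivative[of 0]) (use C1 that in simp_all)
  have cov: "x \<in> \<Omega> \<or> x \<in> - K" for x using K by auto
  have D0: "D x = (\<lambda>_. 0)" if "x \<in> - K" for x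
  proof (cases "x \<in> \<Omega>")
    case True
    have "((\<lambda>_. 0) has_derivative frechet_derivative \<psi> (at x)) (at x)"
      by (rule has_derivative_transform_within_open[OF d[OF True], of "\<Omega> - K"])
        (use supp that True \<Omega> compact_imp_closed[OF K(1)] in auto)
    then show ?thesis using has_derivative_unique[OF _ has_derivative_const] True by (auto simp: D_def)
  qed (simp add: D_def)
  have der: "(\<psi>0 has_derivative D x) (at x)" for x
    using cov[of x]
  proof
    assume x: "x \<in> \<Omega>"
    then show ?thesis
      using has_derivative_transform_within_open[OF d[OF x] \<Omega> x, of \<psi>0] by (simp add: D_def \<psi>0_def)
  next
    assume x: "x \<in> - K"
    show ?thesis unfolding D0[OF x]
      by (rule has_derivative_transform_within_open[OF has_derivative_const oK x])
        (use supp in \<open>auto simp: \<psi>0_def\<close>)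
  qed
  have c1: "continuous_on \<Omega> (\<lambda>x. D x (axis i 1))"
  proof -
    have "continuous_on \<Omega> (\<lambda>x. frechet_derivative \<psi> (at x) (axis i 1))"
      using C1 by (simp add: axis_in_Basis_iff)
    then show ?thesis by (rule continuous_on_cong[THEN iffD1, rotated 2]) (auto simp: D_def)
  qed
  have c2: "continuous_on (- K) (\<lambda>x. D x (axis i 1))"
    by (rule continuous_on_cong[THEN iffD1, OF refl _ continuous_on_const]) (auto simp: D0)
  have "continuous_on (\<Omega> \<union> - K) (\<lambda>x. D x (axis i 1))"
    by (rule continuous_on_open_Un[OF \<Omega> oK c1 c2])
  moreover have "\<Omega> \<union> - K = UNIV" using cov by auto
  ultimately have "continuous_on UNIV (\<lambda>x. D x (axis i 1))" by simp
  moreover have "\<psi>0 x = 0" if "x \<notin> K" for x using that supp by (auto simp: \<psi>0_def)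
  ultimately have "integrable lborel (\<lambda>x. D x (axis i 1))" "(LINT x|lborel. D x (axis i 1)) = 0"
    using integral_partial_compact_support_zero[OF K(1) _ der] by auto
  moreover have "(\<lambda>x. D x (axis i 1)) = (\<lambda>x. indicator \<Omega> x *\<^sub>R partial i \<psi> x)"
    by (auto simp: D_def partial_def fun_eq_iff)
  ultimately show "set_integrable lborel \<Omega> (partial i \<psi>)" "(LINT x:\<Omega>|lborel. partial i \<psi> x) = 0"
    by (simp_all add: set_integrable_def set_lebesgue_integral_def)
qed

text \<open>The integrand is the divergence of \<open>\<phi> W\<close>, which has compact support in \<open>\<Omega>\<close>.\<close>

lemma integral_divergence_free:
  fixes W :: "real^'n::finite \<Rightarrow> real^'n"
  assumes \<Omega>: "open \<Omega>" and W: "Ck_on 1 \<Omega> W"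
    and div: "\<And>x. x \<in> \<Omega> \<Longrightarrow> (\<Sum>i\<in>UNIV. frechet_derivative W (at x) (axis i 1) $ i) = 0"
    and \<phi>: "test_on \<Omega> (\<phi> :: real^'n \<Rightarrow> real)"
  shows "(LINT x:\<Omega>|lborel. d_fun \<phi> x \<bullet> W x) = 0"
proof -
  obtain K where K: "compact K" "K \<subseteq> \<Omega>" "\<And>x. x \<in> \<Omega> - K \<Longrightarrow> \<phi> x = 0"
    using \<phi> unfolding test_on_def by auto
  have \<phi>1: "Ck_on 1 \<Omega> \<phi>" using \<phi> unfolding test_on_def smooth_on_def by blast
  define \<psi> where "\<psi> i x = \<phi> x * W x $ i" for i x
  have Wi: "Ck_on 1 \<Omega> (\<lambda>x. W x $ i)" for i
    using Ck_on_bilinear[OF bounded_bilinear_inner \<Omega> W Ck_on_const[of 1 \<Omega> "axis i 1"]]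
    by (simp add: inner_axis)
  have C: "Ck_on 1 \<Omega> (\<psi> i)" for i
    unfolding \<psi>_def by (rule Ck_on_bilinear[OF bounded_bilinear_mult \<Omega> \<phi>1 Wi])
  have z: "\<psi> i x = 0" if "x \<in> \<Omega> - K" for i x using K(3)[OF that] by (simp add: \<psi>_def)
  note I = integral_partial_zero[OF \<Omega> C K(1,2) z]
  have p: "partial i (\<psi> i) x = d_fun \<phi> x $ i * W x $ i + \<phi> x * frechet_derivative W (at x) (axis i 1) $ i"
    if x: "x \<in> \<Omega>" for i x
  proof -
    have d\<phi>: "(\<phi> has_derivative frechet_derivative \<phi> (at x)) (at x)"
      by (rule Ck_on_has_derivative[of 0]) (use \<phi>1 x in simp_all)
    have dW: "(W has_derivative frechet_derivative W (at x)) (at x)"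
      by (rule Ck_on_has_derivative[of 0]) (use W x in simp_all)
    show ?thesis
      unfolding partial_def \<psi>_def d_fun_def
      by (subst frechet_eqI[OF has_derivative_mult[OF d\<phi> bounded_linear.has_derivative[OF bounded_linear_vec_nth dW]]])
        simp
  qed
  have eq: "(\<Sum>i\<in>UNIV. partial i (\<psi> i) x) = d_fun \<phi> x \<bullet> W x" if "x \<in> \<Omega>" for x
    using div[OF that] by (simp add: p[OF that] sum.distrib sum_distrib_left[symmetric] inner_vec_def)
  have "(LINT x:\<Omega>|lborel. d_fun \<phi> x \<bullet> W x) = (LINT x:\<Omega>|lborel. \<Sum>i\<in>UNIV. partial i (\<psi> i) x)"
    by (rule set_lebesgue_integral_cong) (use \<Omega> eq in auto)
  also have "\<dots> = (\<Sum>i\<in>UNIV. LINT x:\<Omega>|lborel. partial i (\<psi> i) x)"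
    unfolding set_lebesgue_integral_def scaleR_sum_right
    by (rule Bochner_Integration.integral_sum) (rule I(1)[unfolded set_integrable_def])
  finally show ?thesis using I(2) by simp
qed

section \<open>Potential flows on hyperbolic space\<close>

lemma open_hyp_space: "open (hyp_space :: (real^'n::finite) set)"
  by (simp add: hyp_space_def)

lemma hyp_metric_eq_mat: "hyp_metric a x = mat (4 / (a\<^sup>2 * (1 - x \<bullet> x)\<^sup>2))"
  by (simp add: hyp_metric_def power2_norm_eq_inner)

lemma hyp_matrix_inv:
  fixes x :: "real^'n::finite"
  assumes "x \<in> hyp_space" "a > 0"
  shows "matrix_inv (hyp_metric a x) = mat (a\<^sup>2 * (1 - x \<bullet> x)\<^sup>2 / 4)"
  unfolding hyp_metric_eq_mat by (subst matrix_inv_mat) (use hyp_inner_less[OF assms(1)] assms in auto)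

lemma hyp_sharp:
  assumes "x \<in> hyp_space" "a > 0"
  shows "sharp (hyp_metric a) \<omega> x = (a\<^sup>2 * (1 - x \<bullet> x)\<^sup>2 / 4) *\<^sub>R \<omega> x"
  by (simp add: sharp_def hyp_matrix_inv[OF assms] matvec_mat)

lemma hyp_ip_form1:
  assumes "x \<in> hyp_space" "a > 0"
  shows "ip_form1 (hyp_metric a) x \<alpha> \<beta> = (a\<^sup>2 * (1 - x \<bullet> x)\<^sup>2 / 4) * (\<alpha> \<bullet> \<beta>)"
  by (simp add: ip_form1_def hyp_matrix_inv[OF assms] matvec_mat)

lemma hyp_volume_density:
  fixes x :: "real^'n::finite"
  assumes "x \<in> hyp_space" "a > 0"
  shows "sqrt (det (hyp_metric a x)) = (2 / (a * (1 - x \<bullet> x))) ^ CARD('n)"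
proof -
  have "det (mat c :: real^'n^'n) = c ^ CARD('n)" for c
    by (subst det_diagonal) (simp_all add: mat_def)
  moreover have "4 / (a\<^sup>2 * (1 - x \<bullet> x)\<^sup>2) = (2 / (a * (1 - x \<bullet> x)))\<^sup>2"
    by (simp add: power_divide power_mult_distrib)
  moreover have "2 / (a * (1 - x \<bullet> x)) > 0" using assms hyp_inner_less[OF assms(1)] by simp
  ultimately show ?thesis
    unfolding hyp_metric_eq_mat by (simp add: real_sqrt_power)
qed

text \<open>With \<open>q = 1 - |x|\<^sup>2\<close> the inverse metric contributes a factor proportional to \<open>q\<^sup>2\<close> and the volume density one
proportional to \<open>q\<^sup>-\<^sup>n\<close>. Being coclosed for the hyperbolic metric therefore means that the field
\<open>q\<^sup>2\<^sup>-\<^sup>n U\<close> is divergence free in the Euclidean sense.\<close>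

lemma hyp_codiff1_zero:
  fixes U :: "'n::finite oneform"
  assumes n: "CARD('n) \<ge> 2" and a: "a > 0"
    and C1: "Ck_on 1 hyp_space (\<lambda>x. inverse (1 - x \<bullet> x) ^ (CARD('n) - 2) *\<^sub>R U x)"
    and div: "\<And>x. x \<in> hyp_space \<Longrightarrow> (\<Sum>i\<in>UNIV. frechet_derivative
        (\<lambda>x. inverse (1 - x \<bullet> x) ^ (CARD('n) - 2) *\<^sub>R U x) (at x) (axis i 1) $ i) = 0"
  shows "is_codiff1 hyp_space (hyp_metric a) U (\<lambda>_. 0)"
proof -
  let ?W = "\<lambda>x. inverse (1 - x \<bullet> x) ^ (CARD('n) - 2) *\<^sub>R U x"
  have "integral_vol hyp_space (hyp_metric a) (\<lambda>x. ip_form1 (hyp_metric a) x (d_fun \<phi> x) (U x)) = 0"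
    if \<phi>: "test_on hyp_space \<phi>" for \<phi>
  proof -
    have eq: "ip_form1 (hyp_metric a) x (d_fun \<phi> x) (U x) * sqrt (det (hyp_metric a x))
        = (2 / a) ^ (CARD('n) - 2) * (d_fun \<phi> x \<bullet> ?W x)" if x: "x \<in> hyp_space" for x
    proof -
      define q where "q = 1 - x \<bullet> x"
      have q: "q > 0" using hyp_inner_less[OF x] by (simp add: q_def)
      obtain m where m: "CARD('n) = m + 2" using n by (metis add.commute le_Suc_ex)
      show ?thesis
        unfolding hyp_ip_form1[OF x a] hyp_volume_density[OF x a] q_def[symmetric] m
        using q a by (simp add: power_add power_divide power_mult_distrib field_simps power2_eq_square)
    qed
    have "integral_vol hyp_space (hyp_metric a) (\<lambda>x. ip_form1 (hyp_metric a) x (d_fun \<phi> x) (U x))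
       = (LINT x:hyp_space|lborel. (2 / a) ^ (CARD('n) - 2) * (d_fun \<phi> x \<bullet> ?W x))"
      unfolding integral_vol_def
      by (rule set_lebesgue_integral_cong) (simp_all add: eq borel_open[OF open_hyp_space])
    also have "\<dots> = (2 / a) ^ (CARD('n) - 2) * (LINT x:hyp_space|lborel. d_fun \<phi> x \<bullet> ?W x)"
      by (rule set_integral_mult_right)
    finally show ?thesis using integral_divergence_free[OF open_hyp_space C1 div \<phi>] by simp
  qed
  then show ?thesis by (simp add: is_codiff1_def smooth_on_const) (simp add: integral_vol_def)
qed

text \<open>For a closed form \<open>U\<close> one has \<open>\<nabla>\<^sub>U U = d (|U|\<^sup>2 / 2)\<close>: by metric compatibility the right-hand side is
\<open>Y \<mapsto> g(\<nabla>\<^sub>Y U, U)\<close>, and closedness makes \<open>\<nabla>U\<close> symmetric. Here the identity is read off from the explicit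
Christoffel symbols of the ball, where the two multiples of \<open>U\<close> coming from the derivative of the conformal
factor and from the symbols cancel.\<close>

lemma hyp_convection_of_closed_form:
  fixes U :: "'n::finite oneform"
  assumes x: "x \<in> hyp_space" and a: "a > 0"
    and U: "(U has_derivative U') (at x)" and closed: "\<And>h k. U' h \<bullet> k = U' k \<bullet> h"
  shows "((\<lambda>y. (a\<^sup>2 * (1 - y \<bullet> y)\<^sup>2 / 8) * (U y \<bullet> U y)) has_derivative
      (\<lambda>h. cov_form (hyp_metric a) (sharp (hyp_metric a) U) U x \<bullet> h)) (at x)"
proof -
  define q where "q = 1 - x \<bullet> x"
  have q: "q > 0" using hyp_inner_less[OF x] by (simp add: q_def)
  \<comment> \<open>the inverse metric is \<open>\<mu>\<close> times the identity\<close>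
  define \<mu> where "\<mu> y = a\<^sup>2 * (1 - y \<bullet> y)\<^sup>2 / 4" for y :: "real^'n"
  define u where "u = U x"
  have \<mu>x: "\<mu> x = a\<^sup>2 * q\<^sup>2 / 4" by (simp add: \<mu>_def q_def)
  have d\<mu>: "(\<mu> has_derivative (\<lambda>h. - (a\<^sup>2 * q * (x \<bullet> h)))) (at x)"
    unfolding \<mu>_def
    by (rule derivative_eq_intros refl | simp)+
      (simp add: fun_eq_iff q_def inner_commute field_simps)
  have dX: "((\<lambda>y. \<mu> y *\<^sub>R U y) has_derivative (\<lambda>h. \<mu> x *\<^sub>R U' h - (a\<^sup>2 * q * (x \<bullet> h)) *\<^sub>R u)) (at x)"
    using has_derivative_scaleR[OF d\<mu> U] by (simp add: u_def)
  have F: "frechet_derivative (sharp (hyp_metric a) U) (at x) = (\<lambda>h. \<mu> x *\<^sub>R U' h - (a\<^sup>2 * q * (x \<bullet> h)) *\<^sub>R u)"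
    by (rule frechet_cong_open[OF open_hyp_space x _ dX]) (simp add: hyp_sharp[OF _ a] \<mu>_def)
  have X: "sharp (hyp_metric a) U x = \<mu> x *\<^sub>R u" by (simp add: hyp_sharp[OF x a] \<mu>_def u_def)
  have lin: "U' (r *\<^sub>R v) = r *\<^sub>R U' v" for r v
    using linear_cmul[OF has_derivative_linear[OF U]] .
  have "cov_form (hyp_metric a) (sharp (hyp_metric a) U) U x =
      (1 / \<mu> x) *\<^sub>R (\<mu> x *\<^sub>R U' (\<mu> x *\<^sub>R u) - (a\<^sup>2 * q * (x \<bullet> (\<mu> x *\<^sub>R u))) *\<^sub>R u + hG x (\<mu> x *\<^sub>R u) (\<mu> x *\<^sub>R u))"
    unfolding cov_form_def flat_def hyp_cov[OF x a] F X hyp_metric_eq_mat matvec_mat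
    by (simp add: \<mu>_def)
  also have "\<dots> = \<mu> x *\<^sub>R U' u - (a\<^sup>2 * q / 2 * (u \<bullet> u)) *\<^sub>R x"
    unfolding hG_def q_def[symmetric] lin \<mu>x
    using q a by (simp add: vec_eq_iff field_simps power2_eq_square)
  finally have cv: "cov_form (hyp_metric a) (sharp (hyp_metric a) U) U x =
      \<mu> x *\<^sub>R U' u - (a\<^sup>2 * q / 2 * (u \<bullet> u)) *\<^sub>R x" .
  have "((\<lambda>y. (1/2) * (\<mu> y * (U y \<bullet> U y))) has_derivative
      (\<lambda>h. (1/2) * (\<mu> x * (u \<bullet> U' h + U' h \<bullet> u) + - (a\<^sup>2 * q * (x \<bullet> h)) * (u \<bullet> u)))) (at x)"
    unfolding u_def by (intro has_derivative_mult_right has_derivative_mult d\<mu> has_derivative_inner U)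
  moreover have "(1/2) * (\<mu> x * (u \<bullet> U' h + U' h \<bullet> u) + - (a\<^sup>2 * q * (x \<bullet> h)) * (u \<bullet> u)) =
      cov_form (hyp_metric a) (sharp (hyp_metric a) U) U x \<bullet> h" for h
    unfolding cv using closed[of u h] by (simp add: inner_diff_left inner_commute algebra_simps)
  moreover have "(\<lambda>y. (1/2) * (\<mu> y * (U y \<bullet> U y))) = (\<lambda>y. (a\<^sup>2 * (1 - y \<bullet> y)\<^sup>2 / 8) * (U y \<bullet> U y))"
    by (simp add: \<mu>_def)
  ultimately show ?thesis by simp
qed

lemma d_fun_eqI:
  assumes "(f has_derivative (\<lambda>h. v \<bullet> h)) (at x)"
  shows "d_fun f x = v"
  by (simp add: d_fun_def partial_def frechet_eqI[OF assms] inner_axis vec_eq_iff)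

lemma d_form_eq_zero_if_symmetric_deriv:
  fixes U :: "'n::finite oneform"
  assumes "(U has_derivative U') (at x)" "\<And>h k. U' h \<bullet> k = U' k \<bullet> h"
  shows "d_form U x = 0"
proof -
  have "partial i (\<lambda>y. U y $ j) x = U' (axis i 1) $ j" for i j
    unfolding partial_def
    by (rule fun_cong[OF frechet_eqI[OF bounded_linear.has_derivative[OF bounded_linear_vec_nth assms(1)]]])
  moreover have "U' (axis i 1) $ j = U' (axis j 1) $ i" for i j
    using assms(2)[of "axis i 1" "axis j 1"] by (simp add: inner_axis)
  ultimately show ?thesis by (simp add: d_form_def vec_eq_iff)
qed

lemma is_hodge_laplacian_zero:
  fixes U :: "'n::finite oneform"
  assumes \<Omega>: "open \<Omega>" and "is_codiff1 \<Omega> g U (\<lambda>_. 0)" and "\<And>x. x \<in> \<Omega> \<Longrightarrow> d_form U x = 0"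
  shows "is_hodge_laplacian \<Omega> g U (\<lambda>_. 0)"
proof -
  have "integral_vol \<Omega> g (\<lambda>x. ip_form2 g x (d_form \<phi> x) (d_form U x)) = 0" for \<phi> :: "'n oneform"
  proof -
    have "integral_vol \<Omega> g (\<lambda>x. ip_form2 g x (d_form \<phi> x) (d_form U x)) = (LINT x:\<Omega>|lborel. 0)"
      unfolding integral_vol_def
      by (rule set_lebesgue_integral_cong) (use \<Omega> assms(3) in \<open>auto simp: ip_form2_def\<close>)
    then show ?thesis by simp
  qed
  then have "is_codiff2 \<Omega> g (d_form U) (\<lambda>_. 0)"
    by (simp add: is_codiff2_def smooth_on_const ip_form1_def) (simp add: integral_vol_def)
  moreover have "d_fun (\<lambda>_. 0) x = 0" for x :: "real^'n"
    by (rule d_fun_eqI) simp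
  ultimately show ?thesis using assms(2) unfolding is_hodge_laplacian_def
    by (intro exI[of _ "\<lambda>_. 0"]) simp
qed

text \<open>Each term of the stationary equation is exact for \<open>U = dF\<close>: the Laplacian vanishes, the convection
term is \<open>d (|U|\<^sup>2 / 2)\<close>, and the Ricci term is \<open>2 (n - 1) a\<^sup>2 dF\<close> because hyperbolic space is Einstein. The
pressure is minus the sum of the two potentials.\<close>

lemma hyp_potential_flow_navier_stokes:
  fixes U :: "'n::finite oneform" and F :: "real^'n \<Rightarrow> real"
  assumes a: "a > 0"
    and smooth: "smooth_on ({..<0::real} \<times> hyp_space) (\<lambda>p. U (snd p))"
      "smooth_on ({..<0::real} \<times> hyp_space) (\<lambda>p. F (snd p))"
    and F: "\<And>x. x \<in> hyp_space \<Longrightarrow> (F has_derivative (\<lambda>h. U x \<bullet> h)) (at x)"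
    and U: "\<And>x. x \<in> hyp_space \<Longrightarrow> (U has_derivative U' x) (at x)"
    and closed: "\<And>x h k. x \<in> hyp_space \<Longrightarrow> U' x h \<bullet> k = U' x k \<bullet> h"
    and codiff: "is_codiff1 hyp_space (hyp_metric a) U (\<lambda>_. 0)"
  shows "navier_stokes_solution hyp_space (hyp_metric a) (\<lambda>_. U)
    (\<lambda>_ x. - ((a\<^sup>2 * (1 - x \<bullet> x)\<^sup>2 / 8) * (U x \<bullet> U x)) - 2 * (real CARD('n) - 1) * a\<^sup>2 * F x)"
    (is "navier_stokes_solution _ _ _ (\<lambda>_. ?P)")
proof -
  let ?S = "{..<0::real} \<times> (hyp_space :: (real^'n) set)"
  let ?g = "hyp_metric a :: 'n metric"
  have S: "open ?S" by (intro open_Times open_hyp_space) simp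
  note smooth_intros = smooth_on_diff[OF S] smooth_on_mult[OF S] smooth_on_inner[OF S]
    smooth_on_power[OF S] smooth_on_const smooth smooth_on_bounded_linear[OF bounded_linear_snd S]
  have P: "smooth_on ?S (\<lambda>p. ?P (snd p))"
  proof -
    have "smooth_on ?S (\<lambda>p. (- (a\<^sup>2 / 8)) * (1 - snd p \<bullet> snd p)\<^sup>2 * (U (snd p) \<bullet> U (snd p))
        - 2 * (real CARD('n) - 1) * a\<^sup>2 * F (snd p))"
      by (intro smooth_intros)
    then show ?thesis by (simp add: mult_ac)
  qed
  have eq: "vector_derivative (\<lambda>s. U x) (at t) - 0 + cov_form ?g (sharp ?g U) U x - 2 *\<^sub>R ricci ?g U x
      + d_fun ?P x = 0" if x: "x \<in> hyp_space" for t x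
  proof -
    have "(?P has_derivative (\<lambda>h. - (cov_form ?g (sharp ?g U) U x \<bullet> h)
        - 2 * (real CARD('n) - 1) * a\<^sup>2 * (U x \<bullet> h))) (at x)"
      by (intro has_derivative_diff has_derivative_minus has_derivative_mult_right F[OF x]
          hyp_convection_of_closed_form[OF x a U[OF x] closed[OF x]])
    then have "d_fun ?P x = - cov_form ?g (sharp ?g U) U x - (2 * (real CARD('n) - 1) * a\<^sup>2) *\<^sub>R U x"
      by (intro d_fun_eqI) (simp add: inner_diff_left)
    then show ?thesis by (simp add: hyp_ricci[OF x a] algebra_simps)
  qed
  have "is_hodge_laplacian hyp_space ?g U (\<lambda>_. 0)"
    by (rule is_hodge_laplacian_zero[OF open_hyp_space codiff]) (rule d_form_eq_zero_if_symmetric_deriv[OF U closed])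
  then show ?thesis
    unfolding navier_stokes_solution_def case_prod_beta'
    using smooth(1) P codiff eq by blast
qed

section \<open>A bounded potential flow\<close>

text \<open>For a unit vector \<open>e\<close> this is \<open>sinh (a r)\<close>, where \<open>r\<close> is the signed distance to the totally geodesic
hyperplane through the origin orthogonal to \<open>e\<close>.\<close>

definition sinh_dist :: "real^'n::finite \<Rightarrow> real^'n \<Rightarrow> real" where
  "sinh_dist e x = 2 * (e \<bullet> x) / (1 - x \<bullet> x)"

definition sinh_dist_grad :: "real^'n::finite \<Rightarrow> real^'n \<Rightarrow> real^'n" where
  "sinh_dist_grad e x = (2 / (1 - x \<bullet> x)) *\<^sub>R e + (4 * (e \<bullet> x) / (1 - x \<bullet> x)\<^sup>2) *\<^sub>R x"

text \<open>The derivative of the harmonic function with respect to \<open>s = sinh (a r)\<close>: since \<open>ds = a cosh (a r) dr\<close> and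
\<open>cosh\<^sup>2 = 1 + s\<^sup>2\<close>, it corresponds up to the factor \<open>a\<close> to the derivative \<open>cosh(a r)\<^sup>1\<^sup>-\<^sup>n\<close> with respect to \<open>r\<close>.\<close>

definition profile :: "nat \<Rightarrow> real \<Rightarrow> real" where
  "profile n r = (1 + r\<^sup>2) powr (- real n / 2)"

definition potential_flow :: "real^'n::finite \<Rightarrow> real^'n \<Rightarrow> real^'n" where
  "potential_flow e x = profile CARD('n) (sinh_dist e x) *\<^sub>R sinh_dist_grad e x"

lemma one_plus_square_pos: "0 < 1 + r\<^sup>2" for r :: real
  by (simp add: add_pos_nonneg)

lemma profile_deriv:
  "(profile n has_real_derivative (- real n * r / (1 + r\<^sup>2) * profile n r)) (at r)"
proof -
  have "((\<lambda>r. (1 + r\<^sup>2) powr (- real n / 2)) has_real_derivative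
      (- real n / 2) * (1 + r\<^sup>2) powr (- real n / 2 - 1) * (2 * r)) (at r)"
    using one_plus_square_pos[of r]
    by (auto intro!: derivative_eq_intros)
  moreover have "(1 + r\<^sup>2) powr (- real n / 2 - 1) = (1 + r\<^sup>2) powr (- real n / 2) / (1 + r\<^sup>2)"
    using one_plus_square_pos[of r] by (simp add: powr_diff)
  ultimately show ?thesis
    by (simp add: profile_def[abs_def] field_simps)
qed

lemma smooth_on_profile: "smooth_on UNIV (profile n)"
  unfolding profile_def[abs_def]
  by (rule smooth_on_compose_real[OF _ _ _ smooth_on_powr])
    (auto simp: one_plus_square_pos
      intro!: smooth_on_add smooth_on_const smooth_on_power smooth_on_bounded_linear[OF bounded_linear_ident])

lemma profile_antiderivative:
  obtains \<Phi> where "\<And>r. (\<Phi> has_real_derivative profile n r) (at r)" "smooth_on UNIV \<Phi>"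
proof -
  have "\<exists>\<Phi>. \<forall>r::real. -\<infinity> < ereal r \<longrightarrow> ereal r < \<infinity> \<longrightarrow> (\<Phi> has_vector_derivative profile n r) (at r)"
    by (rule einterval_antiderivative) (auto intro: DERIV_isCont profile_deriv)
  then obtain \<Phi> where \<Phi>: "(\<Phi> has_real_derivative profile n r) (at r)" for r
    by (auto simp: has_real_derivative_iff_has_vector_derivative)
  show ?thesis
    by (rule that[OF \<Phi>], rule smooth_on_real_antiderivative[OF _ \<Phi> smooth_on_profile]) simp
qed

lemma inverse_one_minus_norm_square_deriv:
  fixes x :: "real^'n::finite"
  assumes "x \<in> hyp_space"
  shows "((\<lambda>y. inverse (1 - y \<bullet> y)) has_derivative (\<lambda>h. 2 * (x \<bullet> h) * (inverse (1 - x \<bullet> x))\<^sup>2)) (at x)"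
proof -
  have "1 - x \<bullet> x \<noteq> 0" using hyp_inner_less[OF assms] by simp
  then show ?thesis
    by (auto intro!: derivative_eq_intros simp: fun_eq_iff power2_eq_square inner_commute algebra_simps)
qed

lemma sinh_dist_deriv:
  assumes x: "x \<in> hyp_space"
  shows "(sinh_dist e has_derivative (\<lambda>h. sinh_dist_grad e x \<bullet> h)) (at x)"
proof -
  have "((\<lambda>y. 2 * (e \<bullet> y) * inverse (1 - y \<bullet> y)) has_derivative
     (\<lambda>h. 2 * (e \<bullet> x) * (2 * (x \<bullet> h) * (inverse (1 - x \<bullet> x))\<^sup>2) + 2 * (e \<bullet> h) * inverse (1 - x \<bullet> x))) (at x)"
    by (intro has_derivative_mult inverse_one_minus_norm_square_deriv[OF x] has_derivative_mult_right
        has_derivative_inner_right has_derivative_ident)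
  moreover have "(\<lambda>y. 2 * (e \<bullet> y) * inverse (1 - y \<bullet> y)) = sinh_dist e"
    by (simp add: sinh_dist_def fun_eq_iff divide_inverse)
  moreover have "2 * (e \<bullet> x) * (2 * (x \<bullet> h) * (inverse (1 - x \<bullet> x))\<^sup>2) + 2 * (e \<bullet> h) * inverse (1 - x \<bullet> x)
      = sinh_dist_grad e x \<bullet> h" for h
    by (simp add: sinh_dist_grad_def inner_add_left divide_inverse power_inverse)
  ultimately show ?thesis by simp
qed

definition sinh_dist_hess :: "real^'n::finite \<Rightarrow> real^'n \<Rightarrow> real^'n \<Rightarrow> real^'n" where
  "sinh_dist_hess e x h = (4 * (x \<bullet> h) / (1 - x \<bullet> x)\<^sup>2) *\<^sub>R e
     + (4 * (e \<bullet> h) / (1 - x \<bullet> x)\<^sup>2 + 16 * (e \<bullet> x) * (x \<bullet> h) / (1 - x \<bullet> x)^3) *\<^sub>R x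
     + (4 * (e \<bullet> x) / (1 - x \<bullet> x)\<^sup>2) *\<^sub>R h"

lemma sinh_dist_grad_deriv:
  assumes x: "x \<in> hyp_space"
  shows "(sinh_dist_grad e has_derivative sinh_dist_hess e x) (at x)"
proof -
  define i where "i = inverse (1 - x \<bullet> x)"
  have "((\<lambda>y. (2 * inverse (1 - y \<bullet> y)) *\<^sub>R e + (4 * (e \<bullet> y) * (inverse (1 - y \<bullet> y) * inverse (1 - y \<bullet> y))) *\<^sub>R y)
     has_derivative
     (\<lambda>h. (2 * (2 * (x \<bullet> h) * i\<^sup>2)) *\<^sub>R e +
       ((4 * (e \<bullet> x) * (i * i)) *\<^sub>R h
        + (4 * (e \<bullet> x) * (i * (2 * (x \<bullet> h) * i\<^sup>2) + (2 * (x \<bullet> h) * i\<^sup>2) * i) + 4 * (e \<bullet> h) * (i * i)) *\<^sub>R x))) (at x)"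
    unfolding i_def
    by (intro has_derivative_add has_derivative_scaleR_left has_derivative_scaleR has_derivative_mult
        inverse_one_minus_norm_square_deriv[OF x] has_derivative_mult_right
        has_derivative_inner_right has_derivative_ident)
  moreover have "(\<lambda>y. (2 * inverse (1 - y \<bullet> y)) *\<^sub>R e + (4 * (e \<bullet> y) * (inverse (1 - y \<bullet> y) * inverse (1 - y \<bullet> y))) *\<^sub>R y)
      = sinh_dist_grad e"
    by (simp add: sinh_dist_grad_def fun_eq_iff divide_inverse power2_eq_square)
  moreover have "(\<lambda>h. (2 * (2 * (x \<bullet> h) * i\<^sup>2)) *\<^sub>R e +
       ((4 * (e \<bullet> x) * (i * i)) *\<^sub>R h
        + (4 * (e \<bullet> x) * (i * (2 * (x \<bullet> h) * i\<^sup>2) + (2 * (x \<bullet> h) * i\<^sup>2) * i) + 4 * (e \<bullet> h) * (i * i)) *\<^sub>R x))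
      = sinh_dist_hess e x"
    unfolding sinh_dist_hess_def[abs_def] divide_inverse power_inverse[symmetric] i_def[symmetric]
    by (simp add: fun_eq_iff vec_eq_iff algebra_simps power2_eq_square power3_eq_cube)
  ultimately show ?thesis by simp
qed

lemma sinh_dist_hess_symmetric: "sinh_dist_hess e x h \<bullet> k = sinh_dist_hess e x k \<bullet> h"
  by (simp add: sinh_dist_hess_def inner_add_left inner_commute algebra_simps)

text \<open>In hyperbolic terms \<open>|ds|\<^sup>2 = a\<^sup>2 (1 + s\<^sup>2)\<close>, that is \<open>cosh\<^sup>2 = 1 + sinh\<^sup>2\<close>: this is what makes the
hyperbolic norm of the flow a function of \<open>s\<close> alone.\<close>

lemma sinh_dist_grad_square:
  assumes x: "x \<in> hyp_space" and e: "norm e = 1"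
  shows "sinh_dist_grad e x \<bullet> sinh_dist_grad e x = 4 * (1 + (sinh_dist e x)\<^sup>2) / (1 - x \<bullet> x)\<^sup>2"
proof -
  have "e \<bullet> e = 1" using e by (simp add: dot_square_norm)
  then have "sinh_dist_grad e x \<bullet> sinh_dist_grad e x =
      4 / (1 - x \<bullet> x)\<^sup>2 + 16 * (e \<bullet> x)\<^sup>2 / (1 - x \<bullet> x)^3 + 16 * (e \<bullet> x)\<^sup>2 * (x \<bullet> x) / (1 - x \<bullet> x)^4"
    by (simp add: sinh_dist_grad_def inner_add_left inner_add_right inner_commute power2_eq_square
        power3_eq_cube power4_eq_xxxx mult_ac)
  also have "\<dots> = 4 * (1 + (sinh_dist e x)\<^sup>2) / (1 - x \<bullet> x)\<^sup>2"
  proof -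
    define q where "q = 1 - x \<bullet> x"
    have "q \<noteq> 0" "x \<bullet> x = 1 - q" using hyp_inner_less[OF x] by (simp_all add: q_def)
    then show ?thesis
      unfolding sinh_dist_def q_def[symmetric]
      by (simp add: divide_simps) (simp add: algebra_simps eval_nat_numeral)
  qed
  finally show ?thesis .
qed

definition potential_flow_deriv :: "real^'n::finite \<Rightarrow> real^'n \<Rightarrow> real^'n \<Rightarrow> real^'n" where
  "potential_flow_deriv e x h = (let s = sinh_dist e x; G = profile CARD('n) s in
     G *\<^sub>R sinh_dist_hess e x h
     + (- real CARD('n) * s / (1 + s\<^sup>2) * G * (sinh_dist_grad e x \<bullet> h)) *\<^sub>R sinh_dist_grad e x)"

lemma has_derivative_real_chain:
  assumes "(G has_real_derivative G') (at (f x))" "(f has_derivative f') (at x)"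
  shows "((\<lambda>y. G (f y)) has_derivative (\<lambda>h. G' * f' h)) (at x)"
  using has_derivative_compose[OF assms(2) assms(1)[unfolded has_field_derivative_def]] .

lemma potential_flow_deriv:
  assumes x: "x \<in> hyp_space"
  shows "(potential_flow e has_derivative potential_flow_deriv e x) (at x)"
  unfolding potential_flow_def[abs_def] potential_flow_deriv_def[abs_def] Let_def
  by (rule has_derivative_scaleR[OF has_derivative_real_chain[OF profile_deriv sinh_dist_deriv[OF x]]
        sinh_dist_grad_deriv[OF x]])

text \<open>The derivative of \<open>G(s) \<nabla>s\<close> is a multiple of the Hessian of \<open>s\<close> plus a multiple of \<open>\<nabla>s \<otimes> \<nabla>s\<close>, and both
are symmetric.\<close>

lemma potential_flow_closed: "potential_flow_deriv e x h \<bullet> k = potential_flow_deriv e x k \<bullet> h"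
  by (simp only: potential_flow_deriv_def Let_def inner_add_left inner_scaleR_left
      sinh_dist_hess_symmetric[of e x h k] mult_ac)

text \<open>Smoothness is stated along an arbitrary smooth map \<open>X\<close> into the ball: the identity serves for the
coclosedness of the flow, and the projection from space-time for the solution itself.\<close>

lemma sinh_dist_smooth:
  fixes X :: "'a::euclidean_space \<Rightarrow> real^'n::finite"
  assumes S: "open S" and X: "smooth_on S X" "X ` S \<subseteq> hyp_space"
  shows "smooth_on S (\<lambda>p. inverse (1 - X p \<bullet> X p))" "smooth_on S (\<lambda>p. sinh_dist e (X p))"
    "smooth_on S (\<lambda>p. sinh_dist_grad e (X p))"
proof -
  show i: "smooth_on S (\<lambda>p. inverse (1 - X p \<bullet> X p))"
    by (intro smooth_on_inverse smooth_on_diff smooth_on_inner smooth_on_const S X)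
      (use X(2) hyp_inner_less in force)
  have "smooth_on S (\<lambda>p. 2 * (e \<bullet> X p) * inverse (1 - X p \<bullet> X p))"
    by (intro smooth_on_mult smooth_on_inner smooth_on_const S X i)
  then show "smooth_on S (\<lambda>p. sinh_dist e (X p))" by (simp add: sinh_dist_def divide_inverse)
  have "smooth_on S (\<lambda>p. (2 * inverse (1 - X p \<bullet> X p)) *\<^sub>R e
      + (4 * (e \<bullet> X p) * (inverse (1 - X p \<bullet> X p))\<^sup>2) *\<^sub>R X p)"
    by (intro smooth_on_add smooth_on_scaleR smooth_on_mult smooth_on_inner smooth_on_power smooth_on_const S X i)
  then show "smooth_on S (\<lambda>p. sinh_dist_grad e (X p))"
    by (simp add: sinh_dist_grad_def divide_inverse power_inverse)
qed

lemma potential_flow_smooth: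
  fixes X :: "'a::euclidean_space \<Rightarrow> real^'n::finite"
  assumes S: "open S" and X: "smooth_on S X" "X ` S \<subseteq> hyp_space"
  shows "smooth_on S (\<lambda>p. potential_flow e (X p))"
  unfolding potential_flow_def
  by (intro smooth_on_scaleR S sinh_dist_smooth(3) X smooth_on_compose_real[OF S open_UNIV subset_UNIV smooth_on_profile] sinh_dist_smooth(2))

lemma sum_axis_rank_one: "(\<Sum>i\<in>UNIV. (v \<bullet> axis i 1) * (w :: real^'n::finite) $ i) = v \<bullet> w"
  by (simp add: inner_axis) (simp add: inner_vec_def)

text \<open>This is the ordinary differential equation for the profile in disguise. The trace of the derivative
consists of the Euclidean Laplacian of \<open>s\<close> and of the term \<open>G'(s) |\<nabla>s|\<^sup>2\<close>, and
\<open>G' = - n s G / (1 + s\<^sup>2)\<close> is exactly what turns their sum into the radial term that the weight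
\<open>(1 - |x|\<^sup>2)\<^sup>2\<^sup>-\<^sup>n\<close> compensates.\<close>

lemma potential_flow_divergence:
  fixes x :: "real^'n::finite"
  assumes x: "x \<in> hyp_space" and e: "norm e = 1"
  shows "(\<Sum>i\<in>UNIV. potential_flow_deriv e x (axis i 1) $ i) =
    - 2 * (real CARD('n) - 2) / (1 - x \<bullet> x) * (x \<bullet> potential_flow e x)"
proof -
  define q where "q = 1 - x \<bullet> x"
  have q: "q \<noteq> 0" and xx: "x \<bullet> x = 1 - q" using hyp_inner_less[OF x] by (simp_all add: q_def)
  define s where "s = sinh_dist e x"
  define G where "G = profile CARD('n) s"
  define n where "n = real CARD('n)"
  define v where "v = sinh_dist_grad e x"
  have hess: "(\<Sum>i\<in>UNIV. sinh_dist_hess e x (axis i 1) $ i)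
      = (8 + 4 * n) * (e \<bullet> x) / q\<^sup>2 + 16 * (e \<bullet> x) * (1 - q) / q^3"
  proof -
    have "(\<Sum>i\<in>UNIV. sinh_dist_hess e x (axis i 1) $ i)
      = (\<Sum>i\<in>UNIV. 4 / q\<^sup>2 * ((x \<bullet> axis i 1) * e $ i) + 4 / q\<^sup>2 * ((e \<bullet> axis i 1) * x $ i)
          + 16 * (e \<bullet> x) / q^3 * ((x \<bullet> axis i 1) * x $ i) + 4 * (e \<bullet> x) / q\<^sup>2)"
      unfolding sinh_dist_hess_def q_def[symmetric]
      by (intro sum.cong refl) (simp add: algebra_simps)
    also have "\<dots> = 4 / q\<^sup>2 * (x \<bullet> e) + 4 / q\<^sup>2 * (e \<bullet> x) + 16 * (e \<bullet> x) / q^3 * (x \<bullet> x) + n * (4 * (e \<bullet> x) / q\<^sup>2)"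
      by (simp only: sum.distrib sum_distrib_left[symmetric] sum_axis_rank_one) (simp add: n_def)
    finally show ?thesis by (simp add: xx inner_commute add_divide_distrib algebra_simps)
  qed
  have "(\<Sum>i\<in>UNIV. potential_flow_deriv e x (axis i 1) $ i)
      = (\<Sum>i\<in>UNIV. G * sinh_dist_hess e x (axis i 1) $ i + (- n * s / (1 + s\<^sup>2) * G) * ((v \<bullet> axis i 1) * v $ i))"
    by (intro sum.cong refl) (simp add: potential_flow_deriv_def Let_def G_def s_def n_def v_def)
  also have "\<dots> = G * ((8 + 4 * n) * (e \<bullet> x) / q\<^sup>2 + 16 * (e \<bullet> x) * (1 - q) / q^3) + (- n * s / (1 + s\<^sup>2) * G) * (v \<bullet> v)"
    by (simp only: sum.distrib sum_distrib_left[symmetric] sum_axis_rank_one hess)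
  also have "(- n * s / (1 + s\<^sup>2) * G) * (v \<bullet> v) = - n * s * G * (4 / q\<^sup>2)"
  proof -
    have "(- n * s / b * G) * (4 * b / q\<^sup>2) = - n * s * G * (4 / q\<^sup>2)" if "b \<noteq> 0" for b
      using that by simp
    then show ?thesis
      unfolding v_def sinh_dist_grad_square[OF x e] s_def[symmetric] q_def[symmetric]
      using one_plus_square_pos[of s] by (metis less_irrefl)
  qed
  also have "\<dots> = - G * (8 * n * (e \<bullet> x) / q^3)"
    by (simp add: s_def sinh_dist_def q_def[symmetric] power2_eq_square power3_eq_cube mult_ac)
  also have "G * ((8 + 4 * n) * (e \<bullet> x) / q\<^sup>2 + 16 * (e \<bullet> x) * (1 - q) / q^3) + - G * (8 * n * (e \<bullet> x) / q^3)
      = - 2 * (n - 2) / q * (G * (2 * (e \<bullet> x) / q + 4 * (e \<bullet> x) / q\<^sup>2 * (1 - q)))"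
    using q by (simp add: divide_simps) (simp add: algebra_simps eval_nat_numeral)
  also have "G * (2 * (e \<bullet> x) / q + 4 * (e \<bullet> x) / q\<^sup>2 * (1 - q)) = x \<bullet> potential_flow e x"
    by (simp add: potential_flow_def sinh_dist_grad_def G_def s_def xx q_def[symmetric] inner_add_right inner_commute)
  finally show ?thesis by (simp add: n_def q_def)
qed

lemma potential_flow_codiff:
  fixes e :: "real^'n::finite"
  assumes n: "CARD('n) \<ge> 2" and a: "a > 0" and e: "norm e = 1"
  shows "is_codiff1 hyp_space (hyp_metric a) (potential_flow e) (\<lambda>_. 0)"
proof (rule hyp_codiff1_zero[OF n a])
  let ?m = "CARD('n) - 2"
  have id: "smooth_on (hyp_space :: (real^'n) set) (\<lambda>x. x)" "(\<lambda>x. x) ` hyp_space \<subseteq> (hyp_space :: (real^'n) set)"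
    by (simp_all add: smooth_on_bounded_linear[OF bounded_linear_ident] open_hyp_space)
  have "smooth_on hyp_space (\<lambda>x::real^'n. inverse (1 - x \<bullet> x) ^ ?m *\<^sub>R potential_flow e x)"
    by (intro smooth_on_scaleR smooth_on_power open_hyp_space sinh_dist_smooth(1)[OF open_hyp_space id]
        potential_flow_smooth[OF open_hyp_space id])
  then show "Ck_on 1 hyp_space (\<lambda>x::real^'n. inverse (1 - x \<bullet> x) ^ ?m *\<^sub>R potential_flow e x)"
    unfolding smooth_on_def by blast
next
  fix x :: "real^'n" assume x: "x \<in> hyp_space"
  let ?m = "CARD('n) - 2"
  define i where "i = inverse (1 - x \<bullet> x)"
  have "((\<lambda>y. inverse (1 - y \<bullet> y) ^ ?m) has_derivative
      (\<lambda>h. real ?m * i ^ (?m - 1) * (2 * (x \<bullet> h) * i\<^sup>2))) (at x)"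
    unfolding i_def
    by (rule has_derivative_real_chain[OF _ inverse_one_minus_norm_square_deriv[OF x]])
      (auto intro!: derivative_eq_intros)
  moreover have "(\<lambda>h. real ?m * i ^ (?m - 1) * (2 * (x \<bullet> h) * i\<^sup>2)) = (\<lambda>h. 2 * real ?m * i * i ^ ?m * (x \<bullet> h))"
    by (cases ?m) (simp_all add: power2_eq_square fun_eq_iff del: of_nat_diff)
  ultimately have "((\<lambda>y. inverse (1 - y \<bullet> y) ^ ?m) has_derivative (\<lambda>h. 2 * real ?m * i * i ^ ?m * (x \<bullet> h))) (at x)"
    by (simp only:)
  note D = has_derivative_scaleR[OF this potential_flow_deriv[OF x, of e]]
  have "(\<Sum>j\<in>UNIV. frechet_derivative (\<lambda>x. inverse (1 - x \<bullet> x) ^ ?m *\<^sub>R potential_flow e x) (at x) (axis j 1) $ j)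
    = (\<Sum>j\<in>UNIV. i ^ ?m * potential_flow_deriv e x (axis j 1) $ j
        + 2 * real ?m * i * i ^ ?m * ((x \<bullet> axis j 1) * potential_flow e x $ j))"
    unfolding frechet_eqI[OF D] by (intro sum.cong refl) (simp add: i_def)
  also have "\<dots> = i ^ ?m * (- 2 * (real CARD('n) - 2) * i * (x \<bullet> potential_flow e x))
      + 2 * real ?m * i * i ^ ?m * (x \<bullet> potential_flow e x)"
    by (simp only: sum.distrib sum_distrib_left[symmetric] sum_axis_rank_one potential_flow_divergence[OF x e])
      (simp add: i_def divide_inverse)
  also have "\<dots> = 0" using n by (simp add: of_nat_diff algebra_simps)
  finally show "(\<Sum>j\<in>UNIV. frechet_derivative (\<lambda>x. inverse (1 - x \<bullet> x) ^ ?m *\<^sub>R potential_flow e x) (at x) (axis j 1) $ j) = 0" .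
qed

text \<open>The square of the norm is \<open>a\<^sup>2 (1 + s\<^sup>2)\<^sup>1\<^sup>-\<^sup>n\<close>.\<close>

lemma potential_flow_bounded:
  fixes x :: "real^'n::finite"
  assumes x: "x \<in> hyp_space" and a: "a > 0" and e: "norm e = 1"
  shows "form_norm (hyp_metric a) (potential_flow e) x \<le> a"
proof -
  define b where "b = 1 + (sinh_dist e x)\<^sup>2"
  have b: "b \<ge> 1" by (simp add: b_def)
  have q: "1 - x \<bullet> x \<noteq> 0" using hyp_inner_less[OF x] by simp
  have "ip_form1 (hyp_metric a) x (potential_flow e x) (potential_flow e x)
      = a\<^sup>2 * ((profile CARD('n) (sinh_dist e x))\<^sup>2 * b)"
  proof -
    have "potential_flow e x \<bullet> potential_flow e x
        = (profile CARD('n) (sinh_dist e x))\<^sup>2 * (4 * b / (1 - x \<bullet> x)\<^sup>2)"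
      unfolding b_def sinh_dist_grad_square[OF x e, symmetric] by (simp add: potential_flow_def power2_eq_square)
    then show ?thesis unfolding hyp_ip_form1[OF x a] using q by simp
  qed
  also have "(profile CARD('n) (sinh_dist e x))\<^sup>2 = b powr (- real CARD('n))"
  proof -
    have "profile CARD('n) (sinh_dist e x) = b powr (- real CARD('n) / 2)" by (simp add: profile_def b_def)
    then show ?thesis by (simp add: power2_eq_square powr_add[symmetric])
  qed
  also have "b powr (- real CARD('n)) * b = b powr (- real CARD('n) + 1)"
    using b powr_add[of b "- real CARD('n)" 1] by simp
  also have "\<dots> \<le> b powr 0"
    by (rule powr_mono) (use b zero_less_card_finite[where 'a='n] in \<open>auto simp: Suc_le_eq\<close>)
  finally have "ip_form1 (hyp_metric a) x (potential_flow e x) (potential_flow e x) \<le> a\<^sup>2"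
    using a b by (simp add: mult_left_le)
  then show ?thesis unfolding form_norm_def using a by (simp add: real_le_lsqrt)
qed

theorem corollary1p4:
  fixes a :: real
  assumes "CARD('n::finite) \<ge> 2" and "a > 0"
  shows "\<exists>(U :: real \<Rightarrow> real^'n \<Rightarrow> real^'n) (P :: real \<Rightarrow> real^'n \<Rightarrow> real).
    navier_stokes_solution hyp_space (hyp_metric a) U P \<and>
    (\<exists>t<0. \<exists>x\<in>hyp_space. U t x \<noteq> 0) \<and>
    bdd_above ((\<lambda>(t, x). form_norm (hyp_metric a) (U t) x) ` ({..<0} \<times> hyp_space))"
proof -
  define e :: "real^'n" where "e = axis undefined 1"
  have e: "norm e = 1" by (simp add: e_def)
  obtain \<Phi> where \<Phi>: "\<And>r. (\<Phi> has_real_derivative profile CARD('n) r) (at r)" "smooth_on UNIV \<Phi>"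
    using profile_antiderivative by blast
  let ?S = "{..<0::real} \<times> (hyp_space :: (real^'n) set)"
  have S: "open ?S" by (intro open_Times open_hyp_space) simp
  note snd_smooth = smooth_on_bounded_linear[OF bounded_linear_snd S]
  have sub: "snd ` ?S \<subseteq> hyp_space" by auto
  have F: "((\<lambda>x. \<Phi> (sinh_dist e x)) has_derivative (\<lambda>h. potential_flow e x \<bullet> h)) (at x)"
    if "x \<in> hyp_space" for x
    using has_derivative_real_chain[OF \<Phi>(1) sinh_dist_deriv[OF that]] by (simp add: potential_flow_def)
  have "smooth_on ?S (\<lambda>p. \<Phi> (sinh_dist e (snd p)))"
    by (rule smooth_on_compose_real[OF S open_UNIV subset_UNIV \<Phi>(2) sinh_dist_smooth(2)[OF S snd_smooth sub]])
  from hyp_potential_flow_navier_stokes[OF \<open>a > 0\<close> potential_flow_smooth[OF S snd_smooth sub] this F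
      potential_flow_deriv potential_flow_closed potential_flow_codiff[OF assms e]]
  obtain P where "navier_stokes_solution hyp_space (hyp_metric a) (\<lambda>_. potential_flow e) (\<lambda>_. P)"
    by blast
  moreover have "potential_flow e 0 \<noteq> 0"
    using e by (auto simp: potential_flow_def sinh_dist_def sinh_dist_grad_def profile_def)
  then have "\<exists>t<0::real. \<exists>x\<in>hyp_space. potential_flow e x \<noteq> 0"
    by (intro exI[of _ "-1"] conjI bexI[of _ 0]) (auto simp: hyp_space_def)
  moreover have "bdd_above ((\<lambda>(t, x). form_norm (hyp_metric a) (potential_flow e) x) ` ?S)"
    by (rule bdd_aboveI[of _ a]) (auto intro: potential_flow_bounded[OF _ \<open>a > 0\<close> e])
  ultimately show ?thesis by blast
qed

end
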